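(* Let $H^{+}_{n+1}(x,y)$ and $H^{-}_{m+1}(x,y)$ be real homogeneous polynomials of degrees $n+1$ and $m+1$ respectively. Let $X$ be the planar piecewise Hamiltonian system with switching line $y=0$ given by $X=X_+$ for $y\ge 0$ and $X=X_-$ for $y<0$, where $$X_{\pm}:\quad \frac{dx}{dt}=-\frac{\partial H_{\pm}}{\partial y}(x,y),\qquad \frac{dy}{dt}=\frac{\partial H_{\pm}}{\partial x}(x,y),$$ $$H_{+}(x,y)=\frac{x^2+y^2}{2}+H^{+}_{n+1}(x,y),\qquad H_{-}(x,y)=\frac{x^2+y^2}{2}+H^{-}_{m+1}(x,y).$$ Then, for any integers $n\ge 1$ and $m\ge 1$, the origin is not an isochronous $\Sigma$-center of $X$.
   Context: The origin is a $\Sigma$-center of $X$ if it has a neighborhood in which it is surrounded by closed orbits, each formed by a trajectory of $X_+$ in the upper half plane and a trajectory of $X_-$ in the lower half plane. Explicitly: for every sufficiently small $p>0$, the trajectory of $X_+$ starting at $(p,0)$ runs through $\{y>0\}$ until it meets the negative $x$-axis at a point $(\varphi_+(p),0)$, the trajectory of $X_-$ in $\{y<0\}$ that ends at $(p,0)$ starts at a point $(\varphi_-(p),0)$ of the negative $x$-axis, and $\varphi_+(p)=\varphi_-(p)$; the closed orbit $\gamma$ through $(p,0)$ is the union of these two arcs. The period $T(\gamma)$ of such a closed orbit is the sum of the times spent along the $X_+$-arc and the $X_-$-arc. A $\Sigma$-center is isochronous if $T(\gamma)$ is constant, i.e. independent of $\gamma$.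
   Formalization: The case n = m = 1 is excluded, since there the claim fails: with both quadratic forms equal to (x²+y²)/2 every orbit is a circle of period π; the homogeneous polynomials are taken to be nonzero, of exact degrees n+1 and m+1. *)

theory Defs
  imports "HOL-Analysis.Analysis"
begin

(* A binary form that really has degree d: the zero polynomial is excluded. Over the reals the
   polynomial is determined by its function, so it is represented by that function. *)
definition homogeneous_poly :: "nat \<Rightarrow> (real \<Rightarrow> real \<Rightarrow> real) \<Rightarrow> bool" where
  "homogeneous_poly d F \<longleftrightarrow>
     (\<exists>c. (\<exists>i\<le>d. c i \<noteq> 0) \<and> (\<forall>x y. F x y = (\<Sum>i\<le>d. c i * x ^ i * y ^ (d - i))))"

definition hamiltonian_field :: "(real \<Rightarrow> real \<Rightarrow> real) \<Rightarrow> real \<times> real \<Rightarrow> real \<times> real" where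
  "hamiltonian_field H z =
     (- deriv (\<lambda>v. H (fst z) v) (snd z), deriv (\<lambda>u. H u (snd z)) (fst z))"

definition trajectory_on :: "(real \<times> real \<Rightarrow> real \<times> real) \<Rightarrow> real set \<Rightarrow> (real \<Rightarrow> real \<times> real) \<Rightarrow> bool" where
  "trajectory_on V I \<gamma> \<longleftrightarrow> (\<forall>t\<in>I. (\<gamma> has_vector_derivative V (\<gamma> t)) (at t within I))"

(* The piecewise field is given by the pair of fields Xp (on y >= 0) and Xm (on y < 0), both
   defined on the whole plane, so that arcs may begin and end on the switching line. *)

definition upper_arc :: "(real \<times> real \<Rightarrow> real \<times> real) \<Rightarrow> real \<Rightarrow> real \<Rightarrow> real \<Rightarrow> bool" where
  "upper_arc Xp p q T \<longleftrightarrow> T > 0 \<and> q < 0 \<and>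
     (\<exists>\<gamma>. trajectory_on Xp {0..T} \<gamma> \<and> \<gamma> 0 = (p, 0) \<and> \<gamma> T = (q, 0) \<and>
          (\<forall>t\<in>{0<..<T}. snd (\<gamma> t) > 0))"

definition lower_arc :: "(real \<times> real \<Rightarrow> real \<times> real) \<Rightarrow> real \<Rightarrow> real \<Rightarrow> real \<Rightarrow> bool" where
  "lower_arc Xm p q T \<longleftrightarrow> T > 0 \<and> q < 0 \<and>
     (\<exists>\<gamma>. trajectory_on Xm {0..T} \<gamma> \<and> \<gamma> 0 = (q, 0) \<and> \<gamma> T = (p, 0) \<and>
          (\<forall>t\<in>{0<..<T}. snd (\<gamma> t) < 0))"

(* The common endpoint q is the value phi_+(p) = phi_-(p) of the two half-return maps. *)
definition closed_orbit_period ::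
  "(real \<times> real \<Rightarrow> real \<times> real) \<Rightarrow> (real \<times> real \<Rightarrow> real \<times> real) \<Rightarrow> real \<Rightarrow> real \<Rightarrow> bool" where
  "closed_orbit_period Xp Xm p T \<longleftrightarrow>
     (\<exists>q Tp Tm. upper_arc Xp p q Tp \<and> lower_arc Xm p q Tm \<and> T = Tp + Tm)"

definition sigma_center ::
  "(real \<times> real \<Rightarrow> real \<times> real) \<Rightarrow> (real \<times> real \<Rightarrow> real \<times> real) \<Rightarrow> bool" where
  "sigma_center Xp Xm \<longleftrightarrow> (\<exists>\<epsilon>>0. \<forall>p\<in>{0<..<\<epsilon>}. \<exists>T. closed_orbit_period Xp Xm p T)"

definition isochronous_sigma_center ::
  "(real \<times> real \<Rightarrow> real \<times> real) \<Rightarrow> (real \<times> real \<Rightarrow> real \<times> real) \<Rightarrow> bool" where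
  "isochronous_sigma_center Xp Xm \<longleftrightarrow> sigma_center Xp Xm \<and>
     (\<exists>T0. \<exists>\<epsilon>>0. \<forall>p\<in>{0<..<\<epsilon>}. \<forall>T. closed_orbit_period Xp Xm p T \<longrightarrow> T = T0)"

end

(* Put N = n - 1 and let f be the restriction of the form to the unit circle.  In polar coordinates (r, theta)
   an orbit of X_+ of energy s^2/2 satisfies u^2 + 2 z u^(N+2) = 1 with u = r/s and z = s^N f(theta), and its
   angular speed is a rational function of u.  So, writing G(z) for the reciprocal of that speed, the half
   period is the integral of G(s^N f(theta)) over 0 <= theta <= pi.  A lower arc becomes an upper arc after
   reflecting y and reversing time.

   Comparing endpoints leaves two situations.  If both degrees agree and the forms agree on the x-axis, the
   two half periods are evaluated at the same s, and strict convexity of G prevents their sum from being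
   constant.  Otherwise each form has even degree or vanishes on the x-axis; then s^N is a polynomial
   in the starting point p, so each half period continues analytically in p.  If f >= 0 it stays below
   its limit pi; if f has a negative minimum, that minimum is critical and the half period diverges
   logarithmically once the orbit reaches the saddle there.  Both contradict a constant sum.  A quadratic
   form gives a linear field, whose half period is constant by scaling. *)

theory Submission
  imports Defs "HOL-Complex_Analysis.Complex_Analysis"
begin

section \<open>The time density along an orbit\<close>

text \<open>The time density decreases in z and the forms may take both signs, so the variations of
  the two half periods could cancel. Unless both halves share the parameter s^N, the integral
  formula is therefore followed in p beyond the starting points of actual orbits: only the integral
  is studied there, not the flow. The continuation ends when s^N min f reaches
  \<open>crit_level N\<close>, the value at which the angular speed vanishes on the ray of the
  minimum. The obstacle is a form of odd degree that does not vanish on the x-axis. Then s^N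
  contains a square root of a polynomial in p, and a negative minimum of f at an endpoint of [0, pi]
  need not be critical; the integrand may then grow only like the inverse square root of the
  distance to that endpoint, and the half period can stay finite. Comparing endpoints confines this
  to equal degrees and equal values on the axis, where both half periods depend on one parameter and
  a local argument suffices.\<close>

text \<open>\<open>level\<close> solves \<open>u\<^sup>2 + 2 * z * u ^ (N + 2) = 1\<close> for \<open>z\<close>; it is monotone exactly up to the radius
  \<open>crit_radius\<close> where the angular speed vanishes, and \<open>orbit_radius\<close> is its inverse there.\<close>

definition crit_radius :: "nat \<Rightarrow> real" where
  "crit_radius N = sqrt ((real N + 2) / real N)"

definition level :: "nat \<Rightarrow> real \<Rightarrow> real" where
  "level N u = (1 - u\<^sup>2) / (2 * u ^ (N + 2))"

definition angular_speed :: "nat \<Rightarrow> real \<Rightarrow> real" where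
  "angular_speed N u = (real N + 2 - real N * u\<^sup>2) / (2 * u\<^sup>2)"

definition orbit_radius :: "nat \<Rightarrow> real \<Rightarrow> real" where
  "orbit_radius N z = (THE u. 0 < u \<and> u < crit_radius N \<and> level N u = z)"

definition time_density :: "nat \<Rightarrow> real \<Rightarrow> real" where
  "time_density N z = 1 / angular_speed N (orbit_radius N z)"

abbreviation crit_level :: "nat \<Rightarrow> real" where
  "crit_level N \<equiv> level N (crit_radius N)"

text \<open>The angular speed is a factor of this derivative: the energy equation for the radius
  stops being invertible exactly where the orbit stops turning.\<close>

lemma DERIV_level:
  assumes "u > 0"
  shows "(level N has_real_derivative - angular_speed N u / u ^ (N + 1)) (at u)"
proof -
  have 1: "((\<lambda>u. 1 - u\<^sup>2) has_real_derivative - (2 * u)) (at u)"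
    by (auto intro!: derivative_eq_intros)
  have 2: "((\<lambda>u. 2 * u ^ (N + 2)) has_real_derivative 2 * (real (N + 2) * u ^ (N + 1))) (at u)"
    using DERIV_cmult[OF DERIV_pow[of "N + 2" u], of 2] by simp
  have "(- (2 * u) * (2 * u ^ (N + 2)) - (1 - u\<^sup>2) * (2 * (real (N + 2) * u ^ (N + 1)))) / (2 * u ^ (N + 2) * (2 * u ^ (N + 2)))
      = - angular_speed N u / u ^ (N + 1)"
    using assms by (simp add: angular_speed_def divide_simps) (simp add: algebra_simps power2_eq_square)
  with DERIV_divide[OF 1 2] assms show ?thesis by (simp add: level_def[abs_def])
qed

section \<open>Inverting the level function up to the critical radius\<close>

context
  fixes N :: nat
  assumes N: "N \<ge> 1"
begin

lemma crit_radius_sq: "(crit_radius N)\<^sup>2 = (real N + 2) / real N"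
  by (simp add: crit_radius_def)

lemma crit_radius_gt_1: "crit_radius N > 1"
  using N by (simp add: crit_radius_def divide_simps)

text \<open>On a ray with f = -\<mu> < 0 the angular speed vanishes at r^N = 1 / ((N + 2) \<mu>),
  and the energy there satisfies s^N \<mu> = \<open>- crit_level N\<close>, whatever the value of
  \<mu>.\<close>

lemma crit_level_eq: "crit_level N = - 1 / ((real N + 2) * crit_radius N ^ N)"
proof -
  have "1 - (crit_radius N)\<^sup>2 = - 2 / real N"
    using N by (simp add: crit_radius_sq field_simps)
  moreover have "crit_radius N ^ (N + 2) = crit_radius N ^ N * ((real N + 2) / real N)"
    by (simp only: power_add crit_radius_sq)
  ultimately show ?thesis
    using N crit_radius_gt_1 unfolding level_def by (simp only:) (simp add: divide_simps)
qed

lemma crit_level_neg: "crit_level N < 0"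
  using crit_radius_gt_1 by (simp add: crit_level_eq divide_simps)

lemma angular_speed_pos: "0 < u \<Longrightarrow> u < crit_radius N \<Longrightarrow> 0 < angular_speed N u"
proof -
  assume u: "0 < u" "u < crit_radius N"
  then have "u\<^sup>2 < (crit_radius N)\<^sup>2"
    by (intro power_strict_mono) auto
  then show ?thesis
    using u N by (simp add: crit_radius_sq angular_speed_def divide_simps mult.commute)
qed

lemma angular_speed_pos_imp: "0 < u \<Longrightarrow> 0 < angular_speed N u \<Longrightarrow> u < crit_radius N"
proof -
  assume u: "0 < u" "0 < angular_speed N u"
  then have "u\<^sup>2 < (crit_radius N)\<^sup>2"
    using N by (simp add: crit_radius_sq angular_speed_def zero_less_divide_iff divide_simps mult.commute)
  then show ?thesis
    using crit_radius_gt_1 by (smt (verit) power_mono u(1))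
qed

lemma level_strict_antimono:
  assumes "0 < u" "u < v" "v \<le> crit_radius N"
  shows "level N v < level N u"
proof (rule DERIV_neg_imp_decreasing_open[OF assms(2)])
  fix x assume "u < x" "x < v"
  then show "\<exists>y. (level N has_real_derivative y) (at x) \<and> y < 0"
    using assms DERIV_level[of x N] angular_speed_pos[of x] by (intro exI conjI) auto
next
  show "continuous_on {u..v} (level N)"
    using assms by (intro continuous_at_imp_continuous_on) (auto intro!: DERIV_isCont DERIV_level)
qed

lemma level_surj:
  assumes "crit_level N < z"
  shows "\<exists>u. 0 < u \<and> u < crit_radius N \<and> level N u = z"
proof -
  \<comment> \<open>A radius so small that the crude lower bound (3/4) / (2 * (u / 4)) of the level
    already exceeds z.\<close>
  define u where "u = 1 / (4 * (\<bar>z\<bar> + 1))"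
  have u: "0 < u" "u \<le> 1 / 4" by (auto simp: u_def divide_simps)
  have "u ^ (N + 2) \<le> u ^ 2" using u by (intro power_decreasing) auto
  also have "\<dots> \<le> u * (1/4)" using u by (simp add: power2_eq_square)
  finally have 1: "u ^ (N + 2) \<le> u * (1/4)" .
  have 2: "1 - u\<^sup>2 \<ge> 3/4" using u power_mono[of u "1/4" 2] by (simp add: power2_eq_square)
  have "z \<le> (3/4) / (2 * (u * (1/4)))" by (simp add: u_def)
  also have "\<dots> \<le> level N u"
    unfolding level_def using u 1 2 by (intro frac_le) auto
  finally have "z \<le> level N u" .
  moreover have "u < crit_radius N" using u crit_radius_gt_1 by simp
  moreover have "continuous_on {u..crit_radius N} (level N)"
    using u by (intro continuous_at_imp_continuous_on) (auto intro!: DERIV_isCont DERIV_level)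
  ultimately obtain x where x: "u \<le> x" "x \<le> crit_radius N" "level N x = z"
    using IVT2'[of "level N" "crit_radius N" z u] assms by auto
  then show ?thesis
    using u assms by (intro exI[of _ x]) (auto simp: less_le)
qed

lemma orbit_radius_level: "0 < u \<Longrightarrow> u < crit_radius N \<Longrightarrow> orbit_radius N (level N u) = u"
  unfolding orbit_radius_def
  by (rule the_equality) (use level_strict_antimono in \<open>auto, metis less_irrefl less_le linorder_neqE_linordered_idom\<close>)

lemma
  assumes "crit_level N < z"
  shows orbit_radius_pos: "0 < orbit_radius N z"
    and orbit_radius_less: "orbit_radius N z < crit_radius N"
    and level_orbit_radius: "level N (orbit_radius N z) = z"
  using level_surj[OF assms] orbit_radius_level by auto

lemma orbit_radius_strict_antimono:
  assumes "crit_level N < y" "y < z"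
  shows "orbit_radius N z < orbit_radius N y"
proof (rule ccontr)
  assume "\<not> ?thesis"
  then have "orbit_radius N y = orbit_radius N z \<or> orbit_radius N y < orbit_radius N z" by auto
  then show False
    using level_strict_antimono[of "orbit_radius N y" "orbit_radius N z"] assms
      orbit_radius_pos[of y] orbit_radius_less[of z] level_orbit_radius[of y] level_orbit_radius[of z]
    by force
qed

lemma orbit_radius_0: "orbit_radius N 0 = 1"
  using orbit_radius_level[of 1] crit_radius_gt_1 by (simp add: level_def)

lemma isCont_orbit_radius:
  assumes "crit_level N < z"
  shows "isCont (orbit_radius N) z"
proof -
  let ?u = "orbit_radius N z"
  note u = orbit_radius_pos[OF assms] orbit_radius_less[OF assms] level_orbit_radius[OF assms]
  define d where "d = min (?u / 2) ((crit_radius N - ?u) / 2)"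
  have d: "0 < d" using u by (auto simp: d_def)
  have "isCont (orbit_radius N) (level N ?u)"
  proof (rule isCont_inverse_function[OF d, where f = "level N"])
    fix v assume "\<bar>v - ?u\<bar> \<le> d"
    then have "0 < v" "v < crit_radius N" using u by (auto simp: d_def abs_if split: if_splits)
    then show "orbit_radius N (level N v) = v" "isCont (level N) v"
      by (auto intro!: orbit_radius_level DERIV_isCont DERIV_level)
  qed
  then show ?thesis by (simp add: u)
qed

lemma DERIV_orbit_radius:
  assumes "crit_level N < z"
  shows "(orbit_radius N has_real_derivative
           - (orbit_radius N z ^ (N + 1) * time_density N z)) (at z)"
proof -
  note u = orbit_radius_pos[OF assms] orbit_radius_less[OF assms] level_orbit_radius[OF assms]
  have "(orbit_radius N has_real_derivative
           inverse (- angular_speed N (orbit_radius N z) / orbit_radius N z ^ (N + 1))) (at z)"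
  proof (rule DERIV_inverse_function[where a = "crit_level N" and b = "z + 1"])
    show "(level N has_real_derivative - angular_speed N (orbit_radius N z) / orbit_radius N z ^ (N + 1))
            (at (orbit_radius N z))"
      by (rule DERIV_level) fact
  qed (use u assms angular_speed_pos[of "orbit_radius N z"] level_orbit_radius isCont_orbit_radius in auto)
  then show ?thesis by (simp add: time_density_def divide_simps)
qed

lemma time_density_pos: "crit_level N < z \<Longrightarrow> 0 < time_density N z"
  using angular_speed_pos orbit_radius_pos orbit_radius_less by (simp add: time_density_def)

lemma time_density_0: "time_density N 0 = 1"
  by (simp add: time_density_def orbit_radius_0 angular_speed_def)

section \<open>Monotonicity, convexity and growth of the time density\<close>

lemma DERIV_angular_speed:
  "u > 0 \<Longrightarrow> (angular_speed N has_real_derivative - ((real N + 2) / u ^ 3)) (at u)"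
  unfolding angular_speed_def[abs_def]
  by (auto intro!: derivative_eq_intros simp: divide_simps) (simp add: algebra_simps eval_nat_numeral)

text \<open>The quotient of the powers N + 1 and 3 stands for the exponent N - 2, which truncated
  subtraction would spoil for N = 1.\<close>

lemma DERIV_time_density:
  assumes "crit_level N < z"
  shows "(time_density N has_real_derivative
           - ((real N + 2) * (orbit_radius N z ^ (N + 1) / orbit_radius N z ^ 3) * time_density N z ^ 3)) (at z)"
proof -
  note u = orbit_radius_pos[OF assms] orbit_radius_less[OF assms]
  note D = angular_speed_pos[OF u]
  have "((\<lambda>z. angular_speed N (orbit_radius N z)) has_real_derivative
     (- ((real N + 2) / orbit_radius N z ^ 3)) * (- (orbit_radius N z ^ (N + 1) * time_density N z))) (at z)"
    by (rule DERIV_chain2[OF DERIV_angular_speed[OF u(1)] DERIV_orbit_radius[OF assms]])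
  from DERIV_divide[OF DERIV_const[of 1] this] D u show ?thesis
    unfolding time_density_def[abs_def]
    by (simp add: power3_eq_cube divide_simps del: power_Suc) (simp add: mult.assoc del: power_Suc)
qed

lemma angular_speed_antimono: "0 < u \<Longrightarrow> u \<le> v \<Longrightarrow> angular_speed N v \<le> angular_speed N u"
proof -
  assume u: "0 < u" "u \<le> v"
  have *: "angular_speed N w = (real N + 2) / (2 * w\<^sup>2) - real N / 2" if "w > 0" for w
    using that by (simp add: angular_speed_def divide_simps)
  show ?thesis
    unfolding *[OF u(1)] *[OF less_le_trans[OF u]]
    using u by (intro diff_right_mono divide_left_mono mult_left_mono power_mono) auto
qed

lemma time_density_strict_antimono:
  assumes "crit_level N < y" "y < z"
  shows "time_density N z < time_density N y"
proof (rule DERIV_neg_imp_decreasing[OF assms(2)])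
  fix x assume "y \<le> x"
  then have x: "crit_level N < x" using assms by simp
  then show "\<exists>d. (time_density N has_real_derivative d) (at x) \<and> d < 0"
    using DERIV_time_density[OF x] orbit_radius_pos[OF x] time_density_pos[OF x]
    by (intro exI conjI) (assumption, auto)
qed

text \<open>The 1 is \<open>time_density N 0\<close>, so this is strict midpoint convexity between 0
  and z. It follows from the mean value theorem on the two halves of that interval, since the
  derivative is strictly increasing.\<close>

lemma time_density_midpoint:
  assumes "crit_level N < z" "z \<noteq> 0"
  shows "2 * time_density N (z / 2) < time_density N z + 1"
proof -
  let ?d = "\<lambda>z. - ((real N + 2) * (orbit_radius N z ^ (N + 1) / orbit_radius N z ^ 3) * time_density N z ^ 3)"
  \<comment> \<open>Up to the factor -8 (N + 2) this is the derivative of the time density as a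
    function of the radius. It increases with the radius, because the numerator grows and the
    denominator shrinks, and the radius decreases in z.\<close>
  let ?e = "\<lambda>u. u ^ (N + 4) / (real N + 2 - real N * u\<^sup>2) ^ 3"
  have d: "?d y < ?d z" if "crit_level N < y" "y < z" for y z
  proof -
    have z: "crit_level N < z" using that by simp
    note uy = orbit_radius_pos[OF that(1)] orbit_radius_less[OF that(1)]
    note uz = orbit_radius_pos[OF z] orbit_radius_less[OF z]
    have e: "?d x = - 8 * (real N + 2) * ?e (orbit_radius N x)" if "crit_level N < x" for x
      using angular_speed_pos[of "orbit_radius N x"] orbit_radius_pos[OF that] orbit_radius_less[OF that]
      by (simp add: time_density_def angular_speed_def field_simps power_add
          flip: power_mult) (simp add: power_add[symmetric] eval_nat_numeral)
    have pos: "real N + 2 - real N * (orbit_radius N y)\<^sup>2 > 0"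
      using angular_speed_pos[OF uy] uy by (simp add: angular_speed_def zero_less_divide_iff)
    have lt: "orbit_radius N z < orbit_radius N y" by (rule orbit_radius_strict_antimono) fact+
    have "?e (orbit_radius N z) < ?e (orbit_radius N y)"
      using lt uz pos
      by (intro frac_less power_strict_mono power_mono diff_left_mono mult_left_mono) auto
    then have "- 8 * (real N + 2) * ?e (orbit_radius N y) < - 8 * (real N + 2) * ?e (orbit_radius N z)"
      by (intro mult_strict_left_mono_neg) auto
    then show ?thesis unfolding e[OF that(1)] e[OF z] .
  qed
  have cont: "(time_density N has_real_derivative ?d x) (at x)" if "crit_level N < x" for x
    by (rule DERIV_time_density[OF that])
  show ?thesis
  proof (cases "z > 0")
    case True
    obtain x where x: "0 < x" "x < z/2" "time_density N (z/2) - time_density N 0 = (z/2 - 0) * ?d x"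
      using MVT2[of 0 "z/2" "time_density N" ?d] cont True crit_level_neg by force
    obtain y where y: "z/2 < y" "y < z" "time_density N z - time_density N (z/2) = (z - z/2) * ?d y"
      using MVT2[of "z/2" z "time_density N" ?d] cont True crit_level_neg by force
    have "(z/2) * ?d x < (z/2) * ?d y"
      using d[of x y] x y crit_level_neg True by (intro mult_strict_left_mono) auto
    then show ?thesis using x(3) y(3) time_density_0 by simp
  next
    case False
    then have z: "z < 0" using assms by simp
    obtain x where x: "z < x" "x < z/2" "time_density N (z/2) - time_density N z = (z/2 - z) * ?d x"
      using MVT2[of z "z/2" "time_density N" ?d] cont z assms by force
    obtain y where y: "z/2 < y" "y < 0" "time_density N 0 - time_density N (z/2) = (0 - z/2) * ?d y"
      using MVT2[of "z/2" 0 "time_density N" ?d] cont z assms by force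
    have "(-z/2) * ?d x < (-z/2) * ?d y"
      using d[of x y] x y assms z by (intro mult_strict_left_mono) auto
    then show ?thesis using x(3) y(3) time_density_0 by simp
  qed
qed

text \<open>At \<open>crit_radius N\<close> the level has a quadratic minimum and the angular speed
  a simple zero, so the speed is of the order of the square root of the excess level. The constant
  is chosen to make the difference of the two sides monotone on [1, \<open>crit_radius N\<close>],
  using x^3 >= 1 and the largest value of x^(N + 1); both sides vanish at the right end.\<close>

lemma angular_speed_sq_le:
  assumes "1 \<le> u" "u \<le> crit_radius N"
  shows "(angular_speed N u)\<^sup>2 \<le> 2 * (real N + 2) * crit_radius N ^ (N + 1) * (level N u - crit_level N)"
proof -
  define C where "C = 2 * (real N + 2) * crit_radius N ^ (N + 1)"
  define f where "f = (\<lambda>u. C * (level N u - crit_level N) - (angular_speed N u)\<^sup>2)"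
  have "f (crit_radius N) \<le> f u"
  proof (rule DERIV_nonpos_imp_nonincreasing[OF assms(2)])
    fix x assume x: "u \<le> x" "x \<le> crit_radius N"
    have "x ^ (N + 1) \<le> crit_radius N ^ (N + 1)" using x assms by (intro power_mono) auto
    then have "2 * (real N + 2) * x ^ (N + 1) \<le> C"
      unfolding C_def using N by (intro mult_left_mono) auto
    moreover have "1 \<le> x ^ 3" using x assms by (intro one_le_power) auto
    ultimately have "2 * (real N + 2) * x ^ (N + 1) * 1 \<le> C * x ^ 3"
      using N assms x by (intro mult_mono) (auto simp: C_def)
    then have 1: "2 * (real N + 2) / x ^ 3 \<le> C / x ^ (N + 1)"
      using x assms by (simp add: divide_simps del: power_Suc)
    have 2: "0 \<le> angular_speed N x"
      using angular_speed_antimono[of x "crit_radius N"] x assms N crit_radius_gt_1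
      by (simp add: angular_speed_def crit_radius_sq)
    have "(f has_real_derivative C * (- angular_speed N x / x ^ (N + 1))
            - 2 * angular_speed N x * (- ((real N + 2) / x ^ 3))) (at x)"
      unfolding f_def using x assms
      by (auto intro!: derivative_eq_intros DERIV_level DERIV_angular_speed simp: mult_ac)
    moreover have "C * (- angular_speed N x / x ^ (N + 1)) - 2 * angular_speed N x * (- ((real N + 2) / x ^ 3))
        = angular_speed N x * (2 * (real N + 2) / x ^ 3 - C / x ^ (N + 1))"
      by (simp add: algebra_simps)
    ultimately show "\<exists>y. (f has_real_derivative y) (at x) \<and> y \<le> 0"
      using 1 2 by (intro exI conjI) (assumption, simp add: mult_nonneg_nonpos)
  qed
  moreover have "angular_speed N (crit_radius N) = 0"
    using N by (simp add: angular_speed_def crit_radius_sq)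
  ultimately show ?thesis by (simp add: f_def C_def)
qed

text \<open>For z <= 0 the radius is at least 1, where speed and level have been compared. The
  inverse square root becomes a nonintegrable 1 / |t - s| once z reaches the critical level with a
  quadratic minimum in the angle.\<close>

lemma time_density_ge:
  assumes "crit_level N < z" "z \<le> 0"
  shows "1 / sqrt (2 * (real N + 2) * crit_radius N ^ (N + 1) * (z - crit_level N)) \<le> time_density N z"
proof -
  note u = orbit_radius_pos[OF assms(1)] orbit_radius_less[OF assms(1)]
  have "1 \<le> orbit_radius N z"
    using orbit_radius_strict_antimono[of z 0] assms orbit_radius_0 by (cases "z = 0") auto
  from angular_speed_sq_le[OF this] u level_orbit_radius[OF assms(1)]
  have "(angular_speed N (orbit_radius N z))\<^sup>2
      \<le> 2 * (real N + 2) * crit_radius N ^ (N + 1) * (z - crit_level N)" by simp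
  then have "angular_speed N (orbit_radius N z)
      \<le> sqrt (2 * (real N + 2) * crit_radius N ^ (N + 1) * (z - crit_level N))"
    by (rule real_le_rsqrt)
  then show ?thesis
    unfolding time_density_def using angular_speed_pos[OF u] by (intro divide_left_mono mult_pos_pos) linarith+
qed

end

section \<open>Analytic continuation along the real line\<close>

lemma filterlim_of_real_at_right:
  "filterlim complex_of_real (at (complex_of_real a)) (at_right a)"
  unfolding filterlim_at
  by (auto simp: eventually_at_right_less intro!: tendsto_intros eventually_mono[OF eventually_at_right_less])

text \<open>Equality on a real interval to the right of a point is the form in which a constant
  period is known; these reals accumulate at the point, as the identity theorem demands.\<close>

lemma identity_theorem_of_real:
  assumes "f holomorphic_on S" "g holomorphic_on S" "open S" "connected S" "complex_of_real a \<in> S"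
    and eq: "\<forall>\<^sub>F x in at_right a. f (complex_of_real x) = g (complex_of_real x)"
    and "w \<in> S"
  shows "f w = g w"
proof -
  define U where "U = S \<inter> {z. f z = g z}"
  have "complex_of_real a islimpt U"
    unfolding islimpt_iff_eventually
  proof
    assume "\<forall>\<^sub>F z in at (complex_of_real a). z \<notin> U"
    then have 1: "\<forall>\<^sub>F x in at_right a. complex_of_real x \<notin> U"
      by (rule eventually_compose_filterlim[OF _ filterlim_of_real_at_right])
    have "\<forall>\<^sub>F z in at (complex_of_real a). z \<in> S"
      using assms by (intro eventually_at_in_open') auto
    then have "\<forall>\<^sub>F x in at_right a. complex_of_real x \<in> S"
      by (rule eventually_compose_filterlim[OF _ filterlim_of_real_at_right])
    with 1 eq have "\<forall>\<^sub>F x in at_right a. False"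
      by eventually_elim (auto simp: U_def)
    then show False by simp
  qed
  then have "f w - g w = 0"
    by (rule analytic_continuation[OF holomorphic_on_diff[OF assms(1,2)] assms(3,4) _ assms(5) _ _ assms(7), rotated])
       (auto simp: U_def)
  then show ?thesis by simp
qed

lemma analytic_extension_of_real:
  fixes f :: "real \<Rightarrow> complex"
  assumes "\<And>x. x \<in> S \<Longrightarrow> \<exists>g. g analytic_on {complex_of_real x} \<and> (\<forall>\<^sub>F y in nhds x. g (of_real y) = f y)"
  shows "\<exists>g. g analytic_on (of_real ` S) \<and> (\<forall>x\<in>S. g (of_real x) = f x)"
proof -
  have "\<exists>g r. r > 0 \<and> g holomorphic_on ball (complex_of_real x) r \<and> (\<forall>y. dist y x < r \<longrightarrow> g (of_real y) = f y)"
    if x: "x \<in> S" for x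
  proof -
    obtain g where g: "g analytic_on {complex_of_real x}" "\<forall>\<^sub>F y in nhds x. g (of_real y) = f y"
      using assms[OF x] by blast
    obtain r where r: "r > 0" "g holomorphic_on ball (complex_of_real x) r"
      using g(1) by (auto simp: analytic_on_def)
    obtain s where s: "s > 0" "\<forall>y. dist y x < s \<longrightarrow> g (of_real y) = f y"
      using g(2) by (auto simp: eventually_nhds_metric)
    show ?thesis
      using r s by (intro exI[of _ g] exI[of _ "min r s"]) (auto intro: holomorphic_on_subset)
  qed
  then obtain g r where r: "\<And>x. x \<in> S \<Longrightarrow> r x > 0"
    and g: "\<And>x. x \<in> S \<Longrightarrow> g x holomorphic_on ball (complex_of_real x) (r x)"
    and gf: "\<And>x y. x \<in> S \<Longrightarrow> dist y x < r x \<Longrightarrow> g x (of_real y) = f y"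
    by metis
  \<comment> \<open>Two discs centred on the real line intersect in a convex set that meets the real line.\<close>
  have agree: "g x z = g y z"
    if xy: "x \<in> S" "y \<in> S" "z \<in> ball (complex_of_real x) (r x)" "z \<in> ball (complex_of_real y) (r y)" for x y z
  proof -
    have Re: "dist x (Re z) < r x" if "z \<in> ball (complex_of_real x) (r x)" for x
      using that abs_Re_le_cmod[of "complex_of_real x - z"] by (simp add: dist_norm)
    have ev: "\<forall>\<^sub>F u in at_right (Re z). dist u x < r x"
      if "z \<in> ball (complex_of_real x) (r x)" for x
    proof -
      have "\<forall>\<^sub>F u in nhds (Re z). u \<in> ball x (r x)"
        using Re[OF that] by (intro eventually_nhds_in_open) auto
      then show ?thesis
        by (auto simp: eventually_at_filter dist_commute elim: eventually_mono)
    qed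
    show ?thesis
    proof (rule identity_theorem_of_real[of "g x" "ball (of_real x) (r x) \<inter> ball (of_real y) (r y)" "g y" "Re z"])
      show "g x holomorphic_on ball (of_real x) (r x) \<inter> ball (of_real y) (r y)"
        using g[OF xy(1)] by (rule holomorphic_on_subset) auto
      show "g y holomorphic_on ball (of_real x) (r x) \<inter> ball (of_real y) (r y)"
        using g[OF xy(2)] by (rule holomorphic_on_subset) auto
      show "complex_of_real (Re z) \<in> ball (of_real x) (r x) \<inter> ball (of_real y) (r y)"
        using Re xy by (auto simp: dist_of_real)
      show "\<forall>\<^sub>F u in at_right (Re z). g x (of_real u) = g y (of_real u)"
        using ev[OF xy(3)] ev[OF xy(4)] by eventually_elim (simp add: gf xy)
    qed (use xy in \<open>auto intro: convex_connected convex_Int\<close>)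
  qed
  \<comment> \<open>A point off the axis may lie in several discs; \<open>agree\<close> makes the
    chosen centre irrelevant.\<close>
  define G where "G = (\<lambda>z. g (SOME x. x \<in> S \<and> z \<in> ball (complex_of_real x) (r x)) z)"
  have G: "G z = g x z" if "x \<in> S" "z \<in> ball (complex_of_real x) (r x)" for x z
  proof -
    have "\<exists>x. x \<in> S \<and> z \<in> ball (complex_of_real x) (r x)" using that by blast
    from someI_ex[OF this] show ?thesis
      unfolding G_def by (intro agree) (use that in auto)
  qed
  show ?thesis
  proof (intro exI conjI ballI)
    show "G analytic_on of_real ` S"
      unfolding analytic_on_def
    proof
      fix z assume "z \<in> complex_of_real ` S"
      then obtain x where x: "x \<in> S" "z = of_real x" by auto
      have "G holomorphic_on ball z (r x)"
        unfolding x(2) by (rule holomorphic_transform[OF g[OF x(1)] G[OF x(1), symmetric]])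
      with r[OF x(1)] show "\<exists>\<epsilon>>0. G holomorphic_on ball z \<epsilon>" by blast
    qed
    show "G (of_real x) = f x" if "x \<in> S" for x
      using G[OF that, of "of_real x"] r[OF that] gf[OF that, of x] by simp
  qed
qed

text \<open>An open set on which \<open>g\<close> is holomorphic may be disconnected, so the
  identity theorem is applied in the component that contains the whole interval.\<close>

lemma analytic_on_const_on_interval:
  fixes c :: complex
  assumes g: "g analytic_on (of_real ` {0..<P})" and "P > 0"
    and c: "\<forall>\<^sub>F x in at_right 0. g (complex_of_real x) = c"
    and x: "x \<in> {0..<P}"
  shows "g (of_real x) = c"
proof -
  obtain T where T: "open T" "of_real ` {0..<P} \<subseteq> T" "g holomorphic_on T"
    using g by (auto simp: analytic_on_holomorphic)
  define C where "C = connected_component_set T (complex_of_real 0)"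
  have "connected (of_real ` {0..<P} :: complex set)"
    by (rule connected_continuous_image[OF continuous_on_of_real[OF continuous_on_id]]) simp
  then have sub: "of_real ` {0..<P} \<subseteq> C"
    unfolding C_def using T \<open>P > 0\<close> by (intro connected_component_maximal) auto
  have CT: "C \<subseteq> T" by (simp add: C_def connected_component_subset)
  show ?thesis
  proof (rule identity_theorem_of_real[of g C "\<lambda>_. c" 0])
    show "g holomorphic_on C" by (rule holomorphic_on_subset[OF T(3) CT])
    show "open C" "connected C" by (auto simp: C_def T open_connected_component)
  qed (use sub \<open>P > 0\<close> c x in auto)
qed

text \<open>The complexified level has nonzero derivative at every real radius between 0 and the
  critical one, hence a local holomorphic inverse, and the time density is a rational function of
  that inverse.\<close>

lemma analytic_time_density:
  assumes N: "N \<ge> 1"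
  shows "\<exists>g. g analytic_on (of_real ` {crit_level N<..}) \<and>
             (\<forall>x>crit_level N. g (complex_of_real x) = of_real (time_density N x))"
proof -
  have "\<exists>g. g analytic_on (of_real ` {crit_level N<..}) \<and>
             (\<forall>x\<in>{crit_level N<..}. g (complex_of_real x) = of_real (time_density N x))"
  proof (rule analytic_extension_of_real)
    fix x assume "x \<in> {crit_level N<..}"
    then have x: "crit_level N < x" by simp
    define u where "u = orbit_radius N x"
    have u: "u > 0" "u < crit_radius N" "level N u = x"
      using orbit_radius_pos[OF N x] orbit_radius_less[OF N x] level_orbit_radius[OF N x]
      by (auto simp: u_def)
    have pos: "real N + 2 - real N * u\<^sup>2 > 0"
      using angular_speed_pos[OF N u(1,2)] u by (simp add: angular_speed_def zero_less_divide_iff)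
    define q where "q = (\<lambda>u::complex. of_nat N + 2 - of_nat N * u\<^sup>2)"
    have q: "q (of_real t) = of_real (real N + 2 - real N * t\<^sup>2)" for t
      by (simp add: q_def)
    define L where "L = (\<lambda>u::complex. (1 - u\<^sup>2) / (2 * u ^ (N + 2)))"
    have L: "L (of_real t) = of_real (level N t)" for t
      by (simp add: L_def level_def)
    have holL: "L holomorphic_on (- {0})"
      unfolding L_def by (intro holomorphic_intros) auto
    have 1: "((\<lambda>u. 1 - u\<^sup>2) has_field_derivative - (2 * of_real u)) (at (complex_of_real u))"
      by (auto intro!: derivative_eq_intros)
    have "((\<lambda>u. u ^ (N + 2)) has_field_derivative of_nat (N + 2) * (1 * of_real u ^ (N + 2 - Suc 0)))
              (at (complex_of_real u))"
      by (rule DERIV_power[OF DERIV_ident])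
    from DERIV_cmult[OF this, of 2]
    have 2: "((\<lambda>u. 2 * u ^ (N + 2)) has_field_derivative 2 * (of_nat (N + 2) * of_real u ^ (N + 1)))
              (at (complex_of_real u))"
      by simp
    have "(- (2 * of_real u) * (2 * of_real u ^ (N + 2)) -
         (1 - (of_real u)\<^sup>2) * (2 * (of_nat (N + 2) * of_real u ^ (N + 1)))) / (2 * of_real u ^ (N + 2) * (2 * of_real u ^ (N + 2)))
      = - q (of_real u) / (2 * complex_of_real u ^ (N + 3))"
      using u(1) by (simp add: q_def divide_simps) (simp add: algebra_simps eval_nat_numeral)
    with DERIV_divide[OF 1 2] u have "(L has_field_derivative - q (of_real u) / (2 * complex_of_real u ^ (N + 3)))
        (at (complex_of_real u))"
      by (simp add: L_def)
    then have "deriv L (of_real u) \<noteq> 0"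
      using u(1) pos unfolding q by (subst DERIV_imp_deriv) (auto simp del: of_real_add of_real_diff)
    then obtain r where r: "r > 0" "ball (complex_of_real u) r \<subseteq> - {0}" "open (L ` ball (of_real u) r)"
        "inj_on L (ball (complex_of_real u) r)"
      using has_complex_derivative_locally_invertible[OF holL, of "of_real u"] u(1) by auto
    obtain g where g: "g holomorphic_on (L ` ball (of_real u) r)"
        "\<And>z. z \<in> ball (of_real u) r \<Longrightarrow> g (L z) = z"
      using holomorphic_has_inverse[OF holomorphic_on_subset[OF holL r(2)] open_ball r(4)] by metis
    have Lu: "L (of_real u) = of_real x" by (simp add: L u)
    have gx: "g (of_real x) = of_real u" using g(2)[of "of_real u"] r(1) by (simp add: Lu)
    have "complex_of_real x \<in> L ` ball (of_real u) r"
      using r(1) by (intro image_eqI[of _ _ "of_real u"]) (auto simp: Lu)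
    then have ang: "g analytic_on {of_real x}"
      using g(1) r(3) by (auto simp: analytic_at)
    show "\<exists>h. h analytic_on {complex_of_real x} \<and> (\<forall>\<^sub>F y in nhds x. h (of_real y) = of_real (time_density N y))"
    proof (intro exI conjI)
      show "(\<lambda>w. 2 * (g w)\<^sup>2 / q (g w)) analytic_on {complex_of_real x}"
      proof (intro analytic_on_divide analytic_intros ang)
        show "(\<lambda>w. q (g w)) analytic_on {complex_of_real x}"
          unfolding q_def by (intro analytic_intros ang)
        show "q (g z) \<noteq> 0" if "z \<in> {complex_of_real x}" for z
          using that pos by (auto simp: gx q simp del: of_real_add of_real_diff)
      qed
      \<comment> \<open>Continuity of \<open>orbit_radius\<close> selects the right branch: for y
        near x the real radius stays in the disc on which \<open>g\<close> inverts
        \<open>L\<close>.\<close>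
      have "\<forall>\<^sub>F y in nhds x. dist (orbit_radius N y) u < r"
        using isCont_orbit_radius[OF N x] r(1)
        unfolding u_def continuous_at tendsto_iff eventually_at_filter
        by (auto elim!: eventually_mono allE[of _ r] simp: r)
      moreover have "\<forall>\<^sub>F y in nhds x. crit_level N < y"
        using x by (intro eventually_nhds_in_open[of "{crit_level N<..}", simplified])
      ultimately show "\<forall>\<^sub>F y in nhds x. 2 * (g (of_real y))\<^sup>2 / q (g (of_real y)) = of_real (time_density N y)"
      proof eventually_elim
        case (elim y)
        have "complex_of_real (orbit_radius N y) \<in> ball (of_real u) r"
          using elim by (simp add: dist_of_real dist_commute)
        from g(2)[OF this] have "g (of_real y) = of_real (orbit_radius N y)"
          by (simp add: L level_orbit_radius[OF N elim(2)])
        then show ?case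
          by (simp add: time_density_def angular_speed_def q flip: of_real_add of_real_diff)
      qed
    qed
  qed
  then show ?thesis by (simp only: ball_simps greaterThan_iff Ball_def)
qed

text \<open>\<open>g\<close> is holomorphic only near real points. The tube lemma, applied to the
  compact interval of angles, gives one disc of parameters on which all arguments of
  \<open>g\<close> stay in its domain, and there the Leibniz rule applies.\<close>

lemma analytic_on_parametric_integral:
  fixes E :: "complex \<Rightarrow> complex" and f :: "real \<Rightarrow> real"
  assumes g: "g analytic_on of_real ` S" and E: "E holomorphic_on UNIV" and f: "continuous_on UNIV f"
    and S: "\<And>x t. x \<in> A \<Longrightarrow> t \<in> {a..b} \<Longrightarrow> E (of_real x) * of_real (f t) \<in> of_real ` S"
  shows "(\<lambda>w. integral {a..b} (\<lambda>t. g (E w * of_real (f t)))) analytic_on of_real ` A"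
  unfolding analytic_on_def
proof
  fix z assume "z \<in> complex_of_real ` A"
  then obtain x where x: "x \<in> A" "z = of_real x" by auto
  obtain T where T: "open T" "of_real ` S \<subseteq> T" "g holomorphic_on T"
    using g by (auto simp: analytic_on_holomorphic)
  define h where "h = (\<lambda>p. E (fst p) * complex_of_real (f (snd p)))"
  have contE: "continuous_on UNIV E" by (rule holomorphic_on_imp_continuous_on[OF E])
  have conth: "continuous_on UNIV h"
    unfolding h_def
    by (intro continuous_intros continuous_on_compose2[OF contE] continuous_on_compose2[OF f]) auto
  have "open (h -` T)" by (rule open_vimage[OF T(1) conth])
  moreover have "{z} \<times> {a..b} \<subseteq> h -` T"
    using subsetD[OF T(2) S[OF x(1)]] by (auto simp: h_def x(2))
  ultimately obtain X where X: "z \<in> X" "open X" "X \<times> {a..b} \<subseteq> h -` T"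
    using Elementary_Topology.tube_lemma[of "{a..b}" "h -` T" z] by auto
  obtain e where e: "e > 0" "ball z e \<subseteq> X" using X by (meson open_contains_ball)
  have inT: "E w * complex_of_real (f t) \<in> T" if "w \<in> ball z e" "t \<in> {a..b}" for w t
  proof -
    have "(w, t) \<in> h -` T" using that e(2) X(3) by blast
    then show ?thesis by (simp add: h_def)
  qed
  have contg: "continuous_on T g" by (rule holomorphic_on_imp_continuous_on[OF T(3)])
  have contg': "continuous_on T (deriv g)"
    by (intro holomorphic_on_imp_continuous_on holomorphic_deriv T)
  have contE': "continuous_on UNIV (deriv E)"
    by (intro holomorphic_on_imp_continuous_on holomorphic_deriv E open_UNIV)
  have "(\<lambda>w. integral (cbox a b) (\<lambda>t. g (E w * of_real (f t)))) holomorphic_on ball z e"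
  proof (rule leibniz_rule_holomorphic)
    fix w t assume wt: "w \<in> ball z e" "t \<in> cbox a b"
    have "(g has_field_derivative deriv g (E w * of_real (f t))) (at (E w * of_real (f t)))"
      using wt by (intro holomorphic_derivI[OF T(3,1)] inT) auto
    moreover have "((\<lambda>w. E w * of_real (f t)) has_field_derivative deriv E w * of_real (f t)) (at w)"
      by (intro DERIV_cmult_right holomorphic_derivI[OF E]) auto
    ultimately show "((\<lambda>w. g (E w * of_real (f t))) has_field_derivative
        deriv g (E w * of_real (f t)) * (deriv E w * of_real (f t))) (at w within ball z e)"
      by (rule DERIV_chain2[THEN has_field_derivative_at_within])
  next
    fix w assume w: "w \<in> ball z e"
    show "(\<lambda>t. g (E w * of_real (f t))) integrable_on cbox a b"
      by (intro integrable_continuous continuous_on_compose2[OF contg] continuous_intros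
            continuous_on_subset[OF f]) (use inT[OF w] in auto)
  next
    show "continuous_on (ball z e \<times> cbox a b)
        (\<lambda>(w, t). deriv g (E w * of_real (f t)) * (deriv E w * of_real (f t)))"
      unfolding case_prod_unfold
      by (intro continuous_intros continuous_on_compose2[OF contg'] continuous_on_compose2[OF contE']
            continuous_on_compose2[OF contE] continuous_on_compose2[OF f]) (use inT in auto)
  qed simp
  with e(1) show "\<exists>\<epsilon>>0. (\<lambda>w. integral {a..b} (\<lambda>t. g (E w * of_real (f t)))) holomorphic_on ball z \<epsilon>"
    by auto
qed

section \<open>Half periods as functions of the energy\<close>

definition half_period :: "nat \<Rightarrow> (real \<Rightarrow> real) \<Rightarrow> real \<Rightarrow> real" where
  "half_period N f e = integral {0..pi} (\<lambda>t. time_density N (e * f t))"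

text \<open>The value of \<open>s ^ N\<close> for the orbit through \<open>(p, 0)\<close>, where \<open>a\<close> is the value of the form at \<open>(1, 0)\<close>.
  For odd \<open>N\<close> the truncated exponent makes this correct only if \<open>a = 0\<close>.\<close>

definition energy_param :: "nat \<Rightarrow> 'a::comm_semiring_1 \<Rightarrow> 'a \<Rightarrow> 'a" where
  "energy_param N a p = p ^ N * (1 + 2 * a * p ^ N) ^ (N div 2)"

text \<open>The right end is left out because a half period may diverge there; 0 is included so that
  the limit value pi can be read off.\<close>

definition analytic_below :: "(real \<Rightarrow> real) \<Rightarrow> real \<Rightarrow> bool" where
  "analytic_below \<tau> P \<longleftrightarrow>
     (\<exists>g. g analytic_on (of_real ` {0..<P}) \<and> (\<forall>x\<in>{0..<P}. g (complex_of_real x) = of_real (\<tau> x)))"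

lemma analytic_below_mono: "analytic_below \<tau> P \<Longrightarrow> Q \<le> P \<Longrightarrow> analytic_below \<tau> Q"
  unfolding analytic_below_def
  by (elim exE conjE) (intro exI conjI ballI, rule analytic_on_subset, assumption, auto)

lemma analytic_below_add:
  assumes "analytic_below \<sigma> P" "analytic_below \<tau> P"
  shows "analytic_below (\<lambda>x. \<sigma> x + \<tau> x) P"
proof -
  obtain g h where "g analytic_on (of_real ` {0..<P})" "h analytic_on (of_real ` {0..<P})"
      "\<forall>x\<in>{0..<P}. g (complex_of_real x) = of_real (\<sigma> x)" "\<forall>x\<in>{0..<P}. h (complex_of_real x) = of_real (\<tau> x)"
    using assms unfolding analytic_below_def by blast
  then show ?thesis
    unfolding analytic_below_def
    by (intro exI[of _ "\<lambda>z. g z + h z"]) (auto intro: analytic_on_add)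
qed

lemma analytic_below_const: "analytic_below (\<lambda>_. c) P"
  unfolding analytic_below_def by (intro exI[of _ "\<lambda>_. of_real c"]) auto

text \<open>This carries an identity proved for the small p of actual orbits to all of [0, P), where
  only the integral formula is left.\<close>

lemma analytic_below_eq_const:
  assumes "analytic_below \<tau> P" "P > 0" "\<forall>\<^sub>F x in at_right 0. \<tau> x = c" "x \<in> {0..<P}"
  shows "\<tau> x = c"
proof -
  obtain g where g: "g analytic_on (of_real ` {0..<P})" "\<forall>x\<in>{0..<P}. g (complex_of_real x) = of_real (\<tau> x)"
    using assms(1) unfolding analytic_below_def by blast
  have "\<forall>\<^sub>F x in at_right 0. g (complex_of_real x) = of_real c"
    using assms(3) eventually_at_right_less eventually_at_right_real[OF assms(2)]
    by eventually_elim (use g(2) in auto)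
  from analytic_on_const_on_interval[OF g(1) assms(2) this assms(4)] g(2) assms(4) show ?thesis
    by simp
qed

lemma integral_less_at_point:
  fixes f g :: "real \<Rightarrow> real"
  assumes "a < b" "continuous_on {a..b} f" "continuous_on {a..b} g"
    and "\<And>x. x \<in> {a..b} \<Longrightarrow> f x \<le> g x" and "x \<in> {a..b}" "f x < g x"
  shows "integral {a..b} f < integral {a..b} g"
proof -
  have "integral {a..b} (\<lambda>x. g x - f x) \<noteq> 0"
    using assms by (subst integral_eq_0_iff) (force intro!: continuous_intros)+
  moreover have "integral {a..b} f \<le> integral {a..b} g"
    using assms by (intro integral_le integrable_continuous_real) auto
  ultimately show ?thesis
    using assms by (simp add: integral_diff integrable_continuous_real)
qed

context
  fixes N :: nat and f :: "real \<Rightarrow> real"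
  assumes N: "N \<ge> 1" and f: "continuous_on UNIV f"
begin

lemma continuous_on_time_density:
  assumes "\<And>t. t \<in> A \<Longrightarrow> crit_level N < e * f t"
  shows "continuous_on A (\<lambda>t. time_density N (e * f t))"
proof -
  have "continuous_on {crit_level N<..} (time_density N)"
    using DERIV_time_density[OF N]
    by (intro continuous_at_imp_continuous_on) (auto intro: DERIV_isCont)
  then show ?thesis
    by (rule continuous_on_compose2) (use assms in \<open>auto intro!: continuous_intros continuous_on_subset[OF f]\<close>)
qed

lemma half_period_0: "half_period N f 0 = pi"
  by (simp add: half_period_def time_density_0[OF N])

lemma half_period_nonneg:
  assumes "\<And>t. t \<in> {0..pi} \<Longrightarrow> crit_level N < e * f t"
  shows "0 \<le> half_period N f e"
  unfolding half_period_def
  by (intro integral_nonneg integrable_continuous_real continuous_on_time_density)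
     (auto intro!: less_imp_le time_density_pos[OF N] assms)

lemma half_period_less_pi:
  assumes "e > 0" "\<And>t. t \<in> {0..pi} \<Longrightarrow> 0 \<le> f t" "s \<in> {0..pi}" "f s \<noteq> 0"
  shows "half_period N f e < pi"
proof -
  have crit: "crit_level N < e * f t" if "t \<in> {0..pi}" for t
    using crit_level_neg[OF N] assms(1) assms(2)[OF that] by (meson less_le_trans mult_nonneg_nonneg less_imp_le)
  have lt: "time_density N z < 1" if "0 < z" for z
    using time_density_strict_antimono[OF N crit_level_neg[OF N] that] time_density_0[OF N] by simp
  have le: "time_density N z \<le> 1" if "0 \<le> z" for z
    using lt[of z] time_density_0[OF N] that by (cases "z = 0") auto
  have "half_period N f e < integral {0..pi} (\<lambda>_. 1)"
    unfolding half_period_def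
  proof (rule integral_less_at_point)
    show "time_density N (e * f s) < 1"
      using assms(1,4) assms(2)[OF assms(3)] by (intro lt mult_pos_pos) auto
    show "time_density N (e * f t) \<le> 1" if "t \<in> {0..pi}" for t
      using assms(1) assms(2)[OF that] by (intro le mult_nonneg_nonneg) auto
  qed (use assms crit in \<open>auto intro!: continuous_on_time_density\<close>)
  then show ?thesis by simp
qed

text \<open>Since pi is the half period at 0, this is midpoint convexity between 0 and e, integrated
  over the angle. Both forms are kept because strictness in one of two summands is enough.\<close>

lemma half_period_midpoint:
  assumes "\<And>t. t \<in> {0..pi} \<Longrightarrow> crit_level N < e * f t" "0 < e"
  shows "2 * half_period N f (e / 2) \<le> half_period N f e + pi"
    and "s \<in> {0..pi} \<Longrightarrow> f s \<noteq> 0 \<Longrightarrow> 2 * half_period N f (e / 2) < half_period N f e + pi"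
proof -
  have crit2: "crit_level N < e / 2 * f t" if "t \<in> {0..pi}" for t
    using assms(1)[OF that] crit_level_neg[OF N] by (simp add: field_simps)
  have lt: "2 * time_density N (e / 2 * f t) < time_density N (e * f t) + 1" if "t \<in> {0..pi}" "f t \<noteq> 0" for t
    using time_density_midpoint[OF N assms(1)[OF that(1)]] assms(2) that(2) by simp
  have le: "2 * time_density N (e / 2 * f t) \<le> time_density N (e * f t) + 1" if "t \<in> {0..pi}" for t
    using lt[OF that] time_density_0[OF N] by (cases "f t = 0") auto
  note c = continuous_on_time_density[OF assms(1)] continuous_on_time_density[OF crit2]
  have 1: "integral {0..pi} (\<lambda>t. 2 * time_density N (e / 2 * f t)) = 2 * half_period N f (e / 2)"
    by (simp add: half_period_def)
  have 2: "integral {0..pi} (\<lambda>t. time_density N (e * f t) + 1) = half_period N f e + pi"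
    unfolding half_period_def
    by (subst integral_add) (auto intro!: integrable_continuous_real c(1))
  show "2 * half_period N f (e / 2) \<le> half_period N f e + pi"
    unfolding 1[symmetric] 2[symmetric]
    by (intro integral_le integrable_continuous_real continuous_intros c le)
  show "2 * half_period N f (e / 2) < half_period N f e + pi" if "s \<in> {0..pi}" "f s \<noteq> 0"
    unfolding 1[symmetric] 2[symmetric]
    by (rule integral_less_at_point[where x = s])
       (use le lt that in \<open>auto intro!: continuous_intros c simp del: times_divide_eq_left\<close>)
qed

text \<open>The starting point enters through a polynomial, which extends to an entire function;
  \<open>energy_param\<close> is polymorphic in order to serve as its own extension.\<close>

lemma analytic_below_half_period:
  assumes "\<And>p t. p \<in> {0..<P} \<Longrightarrow> t \<in> {0..pi} \<Longrightarrow> crit_level N < energy_param N a p * f t"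
  shows "analytic_below (\<lambda>p. half_period N f (energy_param N a p)) P"
proof -
  obtain g where g: "g analytic_on (of_real ` {crit_level N<..})"
      "\<forall>x>crit_level N. g (complex_of_real x) = of_real (time_density N x)"
    using analytic_time_density[OF N] by blast
  have E: "energy_param N (complex_of_real a) (of_real p) = of_real (energy_param N a p)" for p
    by (simp add: energy_param_def)
  show ?thesis
    unfolding analytic_below_def
  proof (intro exI conjI ballI)
    show "(\<lambda>w. integral {0..pi} (\<lambda>t. g (energy_param N (complex_of_real a) w * of_real (f t))))
        analytic_on of_real ` {0..<P}"
    proof (rule analytic_on_parametric_integral[OF g(1) _ f])
      show "energy_param N (complex_of_real a) holomorphic_on UNIV"
        unfolding energy_param_def[abs_def] by (intro holomorphic_intros)
      show "energy_param N (complex_of_real a) (of_real p) * of_real (f t) \<in> of_real ` {crit_level N<..}"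
        if "p \<in> {0..<P}" "t \<in> {0..pi}" for p t
        using assms[OF that] by (intro image_eqI[of _ _ "energy_param N a p * f t"]) (auto simp: E)
    qed
    fix p assume p: "p \<in> {0..<P}"
    have "integral {0..pi} (\<lambda>t. g (energy_param N (of_real a) (of_real p) * complex_of_real (f t)))
        = integral {0..pi} (complex_of_real \<circ> (\<lambda>t. time_density N (energy_param N a p * f t)))"
      by (intro integral_cong) (use g(2) assms[OF p] in \<open>simp add: E flip: of_real_mult\<close>)
    also have "\<dots> = of_real (half_period N f (energy_param N a p))"
      unfolding half_period_def using assms[OF p]
      by (intro integral_linear integrable_continuous_real continuous_on_time_density bounded_linear_of_real)
    finally show "integral {0..pi} (\<lambda>t. g (energy_param N (of_real a) (of_real p) * complex_of_real (f t)))
        = of_real (half_period N f (energy_param N a p))" .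
  qed
qed

end

section \<open>Logarithmic divergence at a critical minimum of the profile\<close>

lemma integral_log_blowup:
  fixes A d \<eta> c :: real
  assumes "A > 0" "d > 0" "\<eta> > 0"
  shows "integral {c..c + \<eta>} (\<lambda>t. 1 / (d + A * \<bar>t - c\<bar>)) = (ln (d + A * \<eta>) - ln d) / A" (is ?thesis1)
    and "integral {c - \<eta>..c} (\<lambda>t. 1 / (d + A * \<bar>t - c\<bar>)) = (ln (d + A * \<eta>) - ln d) / A" (is ?thesis2)
    and "(\<lambda>t. 1 / (d + A * \<bar>t - c\<bar>)) integrable_on {a..b}"
proof -
  have pos: "d + A * \<bar>x\<bar> > 0" for x using assms by (intro add_pos_nonneg mult_nonneg_nonneg) auto
  have "((\<lambda>t. 1 / (d + A * \<bar>t - c\<bar>)) has_integral (ln (d + A * (c + \<eta> - c)) / A - ln (d + A * (c - c)) / A)) {c..c + \<eta>}"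
  proof (rule fundamental_theorem_of_calculus)
    fix t assume t: "t \<in> {c..c + \<eta>}"
    then have "d + A * (t - c) > 0" using pos[of "t - c"] by auto
    then have "((\<lambda>t. ln (d + A * (t - c)) / A) has_real_derivative 1 / (d + A * (t - c))) (at t within {c..c + \<eta>})"
      using assms by (auto intro!: derivative_eq_intros simp: divide_simps)
    then show "((\<lambda>t. ln (d + A * (t - c)) / A) has_vector_derivative 1 / (d + A * \<bar>t - c\<bar>)) (at t within {c..c + \<eta>})"
      using t by (simp add: has_real_derivative_iff_has_vector_derivative)
  qed (use assms in simp)
  then show ?thesis1 by (simp add: integral_unique diff_divide_distrib)
  have "((\<lambda>t. 1 / (d + A * \<bar>t - c\<bar>)) has_integral (- ln (d + A * (c - c)) / A - (- ln (d + A * (c - (c - \<eta>))) / A))) {c - \<eta>..c}"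
  proof (rule fundamental_theorem_of_calculus)
    fix t assume t: "t \<in> {c - \<eta>..c}"
    then have "d + A * (c - t) > 0" using pos[of "c - t"] by auto
    then have "((\<lambda>t. - ln (d + A * (c - t)) / A) has_real_derivative 1 / (d + A * (c - t))) (at t within {c - \<eta>..c})"
      using assms by (auto intro!: derivative_eq_intros simp: divide_simps)
    then show "((\<lambda>t. - ln (d + A * (c - t)) / A) has_vector_derivative 1 / (d + A * \<bar>t - c\<bar>)) (at t within {c - \<eta>..c})"
      using t by (simp add: has_real_derivative_iff_has_vector_derivative)
  qed (use assms in simp)
  then show ?thesis2 by (simp add: integral_unique diff_divide_distrib)
  show "(\<lambda>t. 1 / (d + A * \<bar>t - c\<bar>)) integrable_on {a..b}"
    using pos by (intro integrable_continuous_real continuous_intros) (metis less_irrefl)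
qed

context
  fixes N :: nat and f :: "real \<Rightarrow> real" and \<mu> K s :: real
  assumes N: "N \<ge> 1" and f: "continuous_on UNIV f" and \<mu>: "\<mu> > 0" and K: "K > 0"
    and fge: "\<And>t. t \<in> {0..pi} \<Longrightarrow> - \<mu> \<le> f t"
    and s: "s \<in> {0..pi}" and fle: "\<And>t. t \<in> {0..pi} \<Longrightarrow> f t \<le> - \<mu> + K * (t - s)\<^sup>2"
begin

text \<open>Near the minimum, C times the excess of e f(t) over the critical level is at most d^2 +
  A^2 (t - s)^2, so its square root is at most d + A |t - s|. Only d depends on e, and it tends to
  0. The length \<eta> keeps f nonpositive, as \<open>time_density_ge\<close> requires, and is at
  most 1 so that the interval fits into [0, pi].\<close>

lemma half_period_lower_bound:
  assumes e: "0 < e" "e * \<mu> < - crit_level N"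
  defines "C \<equiv> 2 * (real N + 2) * crit_radius N ^ (N + 1)"
  defines "d \<equiv> sqrt (C * (- crit_level N - e * \<mu>))" and "A \<equiv> sqrt (C * (- crit_level N / \<mu>) * K)"
    and "\<eta> \<equiv> min 1 (sqrt (\<mu> / K))"
  shows "(ln (d + A * \<eta>) - ln d) / A \<le> half_period N f e"
proof -
  have C: "C > 0" using crit_radius_gt_1[OF N] by (auto simp: C_def intro!: mult_pos_pos)
  have d: "d > 0" using C e by (simp add: d_def)
  have A: "A > 0" unfolding A_def using C K \<mu> crit_level_neg[OF N]
    by (intro real_sqrt_gt_zero mult_pos_pos divide_pos_pos) auto
  have \<eta>: "0 < \<eta>" "\<eta> \<le> 1" "\<eta>\<^sup>2 \<le> \<mu> / K"
  proof -
    show "0 < \<eta>" "\<eta> \<le> 1" using \<mu> K by (auto simp: \<eta>_def)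
    then have "\<eta>\<^sup>2 \<le> (sqrt (\<mu> / K))\<^sup>2" by (intro power_mono) (auto simp: \<eta>_def)
    then show "\<eta>\<^sup>2 \<le> \<mu> / K" using \<mu> K by simp
  qed
  have crit: "crit_level N < e * f t" if "t \<in> {0..pi}" for t
  proof -
    have "e * (- \<mu>) \<le> e * f t" using fge[OF that] e by (intro mult_left_mono) auto
    then show ?thesis using e by simp
  qed
  have bound: "1 / (d + A * \<bar>t - s\<bar>) \<le> time_density N (e * f t)" if t: "t \<in> {0..pi}" "\<bar>t - s\<bar> \<le> \<eta>" for t
  proof -
    have "(t - s)\<^sup>2 \<le> \<eta>\<^sup>2" using t(2) by (simp add: abs_le_square_iff[symmetric])
    then have "K * (t - s)\<^sup>2 \<le> K * (\<mu> / K)" using \<eta>(3) K by (intro mult_left_mono) auto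
    then have neg: "e * f t \<le> 0"
      using fle[OF t(1)] K e by (intro mult_nonneg_nonpos) auto
    have "e * f t \<le> e * (- \<mu> + K * (t - s)\<^sup>2)"
      using fle[OF t(1)] e by (intro mult_left_mono) auto
    \<comment> \<open>In the quadratic term e is replaced by its upper bound, which makes the slope
      A independent of e.\<close>
    also have "\<dots> \<le> - e * \<mu> + (- crit_level N / \<mu>) * (K * (t - s)\<^sup>2)"
    proof -
      have "e \<le> - crit_level N / \<mu>"
        unfolding pos_le_divide_eq[OF \<mu>] using e by simp
      then have "e * (K * (t - s)\<^sup>2) \<le> (- crit_level N / \<mu>) * (K * (t - s)\<^sup>2)"
        using K by (intro mult_right_mono) auto
      then show ?thesis by (simp add: algebra_simps)
    qed
    finally have "C * (e * f t - crit_level N)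
        \<le> C * (- crit_level N - e * \<mu> + (- crit_level N / \<mu>) * (K * (t - s)\<^sup>2))"
      using C by (intro mult_left_mono) auto
    also have "\<dots> = C * (- crit_level N - e * \<mu>) + C * (- crit_level N / \<mu>) * K * (t - s)\<^sup>2"
      by (simp add: algebra_simps)
    finally have "sqrt (C * (e * f t - crit_level N)) \<le> sqrt (C * (- crit_level N - e * \<mu>) + C * (- crit_level N / \<mu>) * K * (t - s)\<^sup>2)"
      by simp
    also have "\<dots> \<le> d + A * \<bar>t - s\<bar>"
      unfolding d_def A_def
    proof (subst real_sqrt_abs[of "t - s", symmetric], subst real_sqrt_mult[symmetric], rule sqrt_add_le_add_sqrt)
      show "0 \<le> C * (- crit_level N - e * \<mu>)" using C e by simp
      have "0 \<le> - crit_level N / \<mu>" using crit_level_neg[OF N] \<mu> by (intro divide_nonneg_pos) auto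
      then show "0 \<le> C * (- crit_level N / \<mu>) * K * (t - s)\<^sup>2" using C K by (intro mult_nonneg_nonneg) auto
    qed
    finally have le: "sqrt (C * (e * f t - crit_level N)) \<le> d + A * \<bar>t - s\<bar>" .
    have "0 < sqrt (C * (e * f t - crit_level N))" using C crit[OF t(1)] by simp
    then have "1 / (d + A * \<bar>t - s\<bar>) \<le> 1 / sqrt (C * (e * f t - crit_level N))"
      using le by (intro divide_left_mono mult_pos_pos) linarith+
    also have "\<dots> \<le> time_density N (e * f t)"
      using time_density_ge[OF N crit[OF t(1)] neg] by (simp add: C_def mult.assoc)
    finally show ?thesis .
  qed
  have int: "(\<lambda>t. time_density N (e * f t)) integrable_on {a..b}" if "{a..b} \<subseteq> {0..pi}" for a b
    using that crit by (intro integrable_continuous_real continuous_on_time_density[OF N f]) auto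
  have main: "integral {a..b} (\<lambda>t. 1 / (d + A * \<bar>t - s\<bar>)) \<le> half_period N f e"
    if ab: "{a..b} \<subseteq> {0..pi}" "\<And>t. t \<in> {a..b} \<Longrightarrow> \<bar>t - s\<bar> \<le> \<eta>" for a b
  proof -
    have "integral {a..b} (\<lambda>t. 1 / (d + A * \<bar>t - s\<bar>)) \<le> integral {a..b} (\<lambda>t. time_density N (e * f t))"
      using ab by (intro integral_le integral_log_blowup(3)[OF A d \<eta>(1)] int bound) auto
    also have "\<dots> \<le> half_period N f e"
      unfolding half_period_def
      by (intro integral_subset_le int) (use ab crit time_density_pos[OF N] in \<open>auto intro!: less_imp_le\<close>)
    finally show ?thesis .
  qed
  show ?thesis
  \<comment> \<open>The minimum may be an endpoint of [0, pi], so only a one-sided interval is used,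
    on the side of s that has room for the length \<eta>.\<close>
  proof (cases "s \<le> pi / 2")
    case True
    then have "{s..s + \<eta>} \<subseteq> {0..pi}" using s \<eta>(2) pi_gt3 by auto
    from main[OF this] show ?thesis
      using integral_log_blowup(1)[OF A d \<eta>(1), of s] by auto
  next
    case False
    then have "{s - \<eta>..s} \<subseteq> {0..pi}" using s \<eta>(2) pi_gt3 by auto
    from main[OF this] show ?thesis
      using integral_log_blowup(2)[OF A d \<eta>(1), of s] by auto
  qed
qed

lemma half_period_at_top:
  "filterlim (half_period N f) at_top (at_left (- crit_level N / \<mu>))"
proof -
  define C where "C = 2 * (real N + 2) * crit_radius N ^ (N + 1)"
  define A where "A = sqrt (C * (- crit_level N / \<mu>) * K)"
  define \<eta> where "\<eta> = min 1 (sqrt (\<mu> / K))"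
  define d where "d = (\<lambda>e. sqrt (C * (- crit_level N - e * \<mu>)))"
  have C: "C > 0" using crit_radius_gt_1[OF N] by (auto simp: C_def intro!: mult_pos_pos)
  have A: "A > 0" unfolding A_def using C K \<mu> crit_level_neg[OF N]
    by (intro real_sqrt_gt_zero mult_pos_pos divide_pos_pos) auto
  have \<eta>: "0 < \<eta>" using \<mu> K by (auto simp: \<eta>_def)
  have pos: "0 < - crit_level N / \<mu>" using crit_level_neg[OF N] \<mu> by (simp add: divide_neg_pos)
  have ev: "\<forall>\<^sub>F e in at_left (- crit_level N / \<mu>). e \<in> {0<..<- crit_level N / \<mu>}"
    by (rule eventually_at_left_real[OF pos])
  have d: "0 < d e" if "e \<in> {0<..<- crit_level N / \<mu>}" for e
  proof -
    have "e * \<mu> < - crit_level N" using that by (simp only: greaterThanLessThan_iff pos_less_divide_eq[OF \<mu>])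
    then show ?thesis using C by (simp add: d_def)
  qed
  have "(d \<longlongrightarrow> sqrt (C * (- crit_level N - (- crit_level N / \<mu>) * \<mu>))) (at_left (- crit_level N / \<mu>))"
    unfolding d_def by (intro tendsto_intros)
  then have "filterlim d (at_right 0) (at_left (- crit_level N / \<mu>))"
    using \<mu> eventually_mono[OF ev, of "\<lambda>e. 0 < d e"] d
    by (auto simp: filterlim_at elim!: eventually_mono)
  then have "filterlim (\<lambda>e. ln (d e)) at_bot (at_left (- crit_level N / \<mu>))"
    by (rule filterlim_compose[OF ln_at_0])
  then have "filterlim (\<lambda>e. - ln (d e)) at_top (at_left (- crit_level N / \<mu>))"
    by (simp add: filterlim_uminus_at_bot)
  then have "filterlim (\<lambda>e. ln (A * \<eta>) + - ln (d e)) at_top (at_left (- crit_level N / \<mu>))"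
    by (intro filterlim_tendsto_add_at_top[OF tendsto_const])
  then have lim: "filterlim (\<lambda>e. (1 / A) * (ln (A * \<eta>) + - ln (d e))) at_top (at_left (- crit_level N / \<mu>))"
    using A by (intro filterlim_tendsto_pos_mult_at_top[OF tendsto_const]) auto
  show ?thesis
  proof (rule filterlim_at_top_mono[OF lim eventually_mono[OF ev]])
    fix e assume e: "e \<in> {0<..<- crit_level N / \<mu>}"
    have "ln (A * \<eta>) \<le> ln (d e + A * \<eta>)"
      using d[OF e] A \<eta> by (subst ln_le_cancel_iff) (auto intro!: add_pos_pos mult_pos_pos)
    then have "(1 / A) * (ln (A * \<eta>) + - ln (d e)) \<le> (ln (d e + A * \<eta>) - ln (d e)) / A"
      using A by (simp add: divide_right_mono)
    also have "\<dots> \<le> half_period N f e"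
    proof -
      have "0 < e" "e * \<mu> < - crit_level N"
        using e by (simp_all only: greaterThanLessThan_iff pos_less_divide_eq[OF \<mu>])
      then show ?thesis
        using half_period_lower_bound[of e] by (simp add: C_def A_def \<eta>_def d_def)
    qed
    finally show "(1 / A) * (ln (A * \<eta>) + - ln (d e)) \<le> half_period N f e" .
  qed
qed

end

text \<open>P is the least starting point at which the critical level is reached on the ray of the
  minimum. Compactness supplies it without a monotonicity argument for
  \<open>energy_param\<close>.\<close>

lemma energy_param_reaches_crit:
  fixes a \<mu> :: real
  assumes N: "N \<ge> 1" and \<mu>: "\<mu> > 0" "- \<mu> \<le> a" and a: "even N \<or> a = 0"
  obtains P where "P > 0" "energy_param N a P * \<mu> = - crit_level N"
    "\<And>p. p \<in> {0..<P} \<Longrightarrow> 0 \<le> energy_param N a p \<and> energy_param N a p * \<mu> < - crit_level N"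
proof -
  \<comment> \<open>The radius at which the angular speed vanishes on a ray where the form has the
    value -\<mu>. Since a >= -\<mu>, the factor 1 + 2 a p^N stays above N / (N + 2), the inverse
    square of the critical radius, up to p = q.\<close>
  define q where "q = root N (1 / ((real N + 2) * \<mu>))"
  have q: "q > 0" "q ^ N = 1 / ((real N + 2) * \<mu>)"
    using N \<mu> by (auto simp: q_def)
  have base: "real N / (real N + 2) \<le> 1 + 2 * a * p ^ N" if "p \<in> {0..q}" for p
  proof -
    have "\<mu> * p ^ N \<le> \<mu> * q ^ N" using that \<mu> by (intro mult_left_mono power_mono) auto
    also have "\<dots> = 1 / (real N + 2)" using q(2) \<mu> by simp
    finally have "- 2 / (real N + 2) \<le> 2 * (- \<mu> * p ^ N)" by simp
    also have "\<dots> \<le> 2 * (a * p ^ N)" using that \<mu> by (intro mult_left_mono mult_right_mono) auto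
    finally show ?thesis by (simp add: field_simps)
  qed
  have nonneg: "0 \<le> energy_param N a p" if "p \<in> {0..q}" for p
  proof -
    have "0 \<le> real N / (real N + 2)" by simp
    also have "\<dots> \<le> 1 + 2 * a * p ^ N" by (rule base[OF that])
    finally show ?thesis using that by (simp add: energy_param_def)
  qed
  have cr: "crit_radius N ^ N > 0" using crit_radius_gt_1[OF N] by simp
  have reach: "- crit_level N \<le> energy_param N a q * \<mu>"
  proof -
    have "1 / crit_radius N ^ N \<le> (1 + 2 * a * q ^ N) ^ (N div 2)"
    \<comment> \<open>For a = 0 the rounded exponent acts on 1 and is harmless; otherwise N is even
      and the power is exactly that of the critical radius.\<close>
    proof (cases "a = 0")
      case True
      then show ?thesis using crit_radius_gt_1[OF N] one_le_power[of "crit_radius N" N] by simp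
    next
      case False
      then obtain k where k: "N = 2 * k" using a by (auto elim: evenE)
      have "crit_radius N ^ N = ((real N + 2) / real N) ^ k"
        unfolding crit_radius_sq[OF N, symmetric] by (simp add: k power_mult)
      then have "1 / crit_radius N ^ N = (real N / (real N + 2)) ^ k"
        by (simp add: power_divide)
      also have "\<dots> \<le> (1 + 2 * a * q ^ N) ^ k" using base[of q] q(1) by (intro power_mono) auto
      finally show ?thesis by (simp add: k)
    qed
    then have "1 / (real N + 2) * (1 / crit_radius N ^ N) \<le> 1 / (real N + 2) * (1 + 2 * a * q ^ N) ^ (N div 2)"
      by (intro mult_left_mono) auto
    moreover have "energy_param N a q * \<mu> = 1 / (real N + 2) * (1 + 2 * a * q ^ N) ^ (N div 2)"
      using \<mu> by (simp add: energy_param_def q(2))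
    ultimately show ?thesis using crit_level_eq[OF N] by simp
  qed
  have cont: "continuous_on A (\<lambda>p. energy_param N a p * \<mu>)" for A
    unfolding energy_param_def by (intro continuous_intros)
  define S where "S = {p \<in> {0..q}. - crit_level N \<le> energy_param N a p * \<mu>}"
  have "compact S"
    unfolding S_def
    using continuous_closed_preimage[OF cont closed_atLeastAtMost closed_atLeast, of 0 q "- crit_level N"]
    by (auto simp: compact_eq_bounded_closed vimage_def Int_def intro: bounded_subset[of "{0..q}"])
  moreover have "q \<in> S" using q(1) reach by (simp add: S_def)
  ultimately obtain P where P: "P \<in> S" "\<And>p. p \<in> S \<Longrightarrow> P \<le> p"
    using compact_attains_inf[of S] by blast
  have e0: "energy_param N a 0 = 0" using N by (simp add: energy_param_def)
  have "P \<noteq> 0" using P(1) crit_level_neg[OF N] by (auto simp: S_def e0)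
  then have Ppos: "P > 0" using P(1) by (auto simp: S_def)
  obtain p where p: "0 \<le> p" "p \<le> P" "energy_param N a p * \<mu> = - crit_level N"
    using IVT'[of "\<lambda>p. energy_param N a p * \<mu>" 0 "- crit_level N" P] P(1) cont Ppos crit_level_neg[OF N]
    by (auto simp: S_def e0)
  then have "p \<in> S" using P(1) by (auto simp: S_def)
  then have "p = P" using P(2) p by force
  show thesis
  proof
    fix x assume x: "x \<in> {0..<P}"
    then have "x \<notin> S" using P(2) by force
    then show "0 \<le> energy_param N a x \<and> energy_param N a x * \<mu> < - crit_level N"
      using x P(1) nonneg[of x] by (auto simp: S_def)
  qed (use p \<open>p = P\<close> Ppos in auto)
qed

section \<open>Binary forms and their Hamiltonian fields\<close>

lemma homogeneous_poly_scale:
  assumes "homogeneous_poly d F"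
  shows "F (r * x) (r * y) = r ^ d * F x y"
proof -
  obtain c where c: "F = (\<lambda>x y. \<Sum>i\<le>d. c i * x ^ i * y ^ (d - i))"
    using assms unfolding homogeneous_poly_def by blast
  have "c i * (r * x) ^ i * (r * y) ^ (d - i) = r ^ d * (c i * x ^ i * y ^ (d - i))" if "i \<le> d" for i
    using that power_add[of r i "d - i"] by (simp add: power_mult_distrib)
  then show ?thesis
    unfolding c sum_distrib_left by (intro sum.cong refl) simp
qed

lemma homogeneous_poly_reflect:
  assumes "homogeneous_poly d F"
  shows "homogeneous_poly d (\<lambda>x y. F x (- y))"
proof -
  obtain c where c: "\<exists>i\<le>d. c i \<noteq> 0" "\<And>x y. F x y = (\<Sum>i\<le>d. c i * x ^ i * y ^ (d - i))"
    using assms unfolding homogeneous_poly_def by blast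
  have "F x (- y) = (\<Sum>i\<le>d. (c i * (- 1) ^ (d - i)) * x ^ i * y ^ (d - i))" for x y
    unfolding c(2) by (intro sum.cong refl) (simp add: power_minus[of y])
  then show ?thesis
    unfolding homogeneous_poly_def
    by (intro exI[of _ "\<lambda>i. c i * (- 1) ^ (d - i)"] conjI) (use c(1) in auto)
qed

lemma homogeneous_poly_bound:
  assumes "homogeneous_poly d F"
  obtains M where "M > 0" "\<And>x y. \<bar>F x y\<bar> \<le> M * sqrt (x\<^sup>2 + y\<^sup>2) ^ d"
proof -
  obtain c where c: "F = (\<lambda>x y. \<Sum>i\<le>d. c i * x ^ i * y ^ (d - i))"
    using assms unfolding homogeneous_poly_def by blast
  have "\<bar>F x y\<bar> \<le> ((\<Sum>i\<le>d. \<bar>c i\<bar>) + 1) * sqrt (x\<^sup>2 + y\<^sup>2) ^ d" for x y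
  proof -
    let ?r = "sqrt (x\<^sup>2 + y\<^sup>2)"
    have "\<bar>F x y\<bar> \<le> (\<Sum>i\<le>d. \<bar>c i * x ^ i * y ^ (d - i)\<bar>)"
      unfolding c by (rule sum_abs)
    also have "\<dots> \<le> (\<Sum>i\<le>d. \<bar>c i\<bar> * ?r ^ d)"
    proof (rule sum_mono)
      fix i assume i: "i \<in> {..d}"
      have "\<bar>x\<bar> ^ i * \<bar>y\<bar> ^ (d - i) \<le> ?r ^ i * ?r ^ (d - i)"
        by (intro mult_mono power_mono) auto
      also have "\<dots> = ?r ^ d" using i by (simp flip: power_add)
      finally show "\<bar>c i * x ^ i * y ^ (d - i)\<bar> \<le> \<bar>c i\<bar> * ?r ^ d"
        by (simp add: abs_mult power_abs mult.assoc mult_left_mono)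
    qed
    also have "\<dots> \<le> ((\<Sum>i\<le>d. \<bar>c i\<bar>) + 1) * ?r ^ d"
      by (simp add: sum_distrib_right distrib_right)
    finally show ?thesis .
  qed
  then show thesis
    by (rule that[rotated]) (auto intro!: add_nonneg_pos sum_nonneg)
qed

text \<open>The chain rule along arbitrary curves. Constant curves give the partial derivatives, and
  derivatives within a set cover the one-sided ones at the ends of an arc.\<close>

definition has_partials :: "(real \<Rightarrow> real \<Rightarrow> real) \<Rightarrow> (real \<Rightarrow> real \<Rightarrow> real) \<Rightarrow> (real \<Rightarrow> real \<Rightarrow> real) \<Rightarrow> bool" where
  "has_partials F Fx Fy \<longleftrightarrow>
     (\<forall>x y x' y' t S. (x has_real_derivative x') (at t within S) \<longrightarrow> (y has_real_derivative y') (at t within S) \<longrightarrow>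
        ((\<lambda>t. F (x t) (y t)) has_real_derivative Fx (x t) (y t) * x' + Fy (x t) (y t) * y') (at t within S))"

lemma has_partialsD:
  assumes "has_partials F Fx Fy" "(x has_real_derivative x') (at t within S)" "(y has_real_derivative y') (at t within S)"
  shows "((\<lambda>t. F (x t) (y t)) has_real_derivative Fx (x t) (y t) * x' + Fy (x t) (y t) * y') (at t within S)"
  using assms unfolding has_partials_def by blast

text \<open>The second property is Euler's identity; it turns the angular speed into an expression
  in F alone.\<close>

lemma homogeneous_poly_partials:
  assumes "homogeneous_poly d F"
  obtains Fx Fy where "has_partials F Fx Fy"
    "\<And>x y. x * Fx x y + y * Fy x y = real d * F x y"
proof -
  obtain c where c: "F = (\<lambda>x y. \<Sum>i\<le>d. c i * x ^ i * y ^ (d - i))"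
    using assms unfolding homogeneous_poly_def by blast
  define Fx where "Fx = (\<lambda>x y. \<Sum>i\<le>d. c i * (real i * x ^ (i - 1)) * y ^ (d - i))"
  define Fy where "Fy = (\<lambda>x y. \<Sum>i\<le>d. c i * x ^ i * (real (d - i) * y ^ (d - i - 1)))"
  show thesis
  proof
    show "has_partials F Fx Fy"
      unfolding has_partials_def
    proof (intro allI impI)
      fix x y x' y' t S
      assume xy: "(x has_real_derivative x') (at t within S)" "(y has_real_derivative y') (at t within S)"
      have "((\<lambda>t. c i * x t ^ i * y t ^ (d - i)) has_real_derivative
          c i * (real i * x t ^ (i - 1)) * y t ^ (d - i) * x' + c i * x t ^ i * (real (d - i) * y t ^ (d - i - 1)) * y')
          (at t within S)" for i
        by (rule derivative_eq_intros xy refl)+ (simp add: algebra_simps)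
      then show "((\<lambda>t. F (x t) (y t)) has_real_derivative Fx (x t) (y t) * x' + Fy (x t) (y t) * y') (at t within S)"
        unfolding c Fx_def Fy_def sum_distrib_right sum.distrib[symmetric] by (rule DERIV_sum)
    qed
  next
    fix x y
    have pow: "z * (real k * z ^ (k - 1)) = real k * z ^ k" for z :: real and k
      by (cases k) auto
    have "x * (c i * (real i * x ^ (i - 1)) * y ^ (d - i)) + y * (c i * x ^ i * (real (d - i) * y ^ (d - i - 1)))
        = real d * (c i * x ^ i * y ^ (d - i))" if "i \<le> d" for i
    proof -
      have "x * (c i * (real i * x ^ (i - 1)) * y ^ (d - i)) + y * (c i * x ^ i * (real (d - i) * y ^ (d - i - 1)))
          = c i * (x * (real i * x ^ (i - 1))) * y ^ (d - i) + c i * x ^ i * (y * (real (d - i) * y ^ (d - i - 1)))"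
        by (simp add: algebra_simps)
      also have "\<dots> = (real i + real (d - i)) * (c i * x ^ i * y ^ (d - i))"
        unfolding pow by (simp add: algebra_simps)
      finally show ?thesis using that by (simp add: of_nat_diff)
    qed
    then show "x * Fx x y + y * Fy x y = real d * F x y"
      unfolding c Fx_def Fy_def sum_distrib_left sum.distrib[symmetric] by (intro sum.cong refl) simp
  qed
qed

lemma hamiltonian_field_eq:
  assumes "has_partials F Fx Fy"
  shows "hamiltonian_field (\<lambda>x y. (x\<^sup>2 + y\<^sup>2) / 2 + F x y) (x, y) = (- (y + Fy x y), x + Fx x y)"
proof -
  have "((\<lambda>v. (x\<^sup>2 + v\<^sup>2) / 2 + F x v) has_real_derivative y + Fy x y) (at y)"
    using has_partialsD[OF assms DERIV_const[of x "at y"] DERIV_ident] by (auto intro!: derivative_eq_intros)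
  moreover have "((\<lambda>u. (u\<^sup>2 + y\<^sup>2) / 2 + F u y) has_real_derivative x + Fx x y) (at x)"
    using has_partialsD[OF assms DERIV_ident DERIV_const[of y "at x"]] by (auto intro!: derivative_eq_intros)
  ultimately show ?thesis by (simp add: hamiltonian_field_def DERIV_imp_deriv)
qed

lemma trajectory_components:
  assumes F: "has_partials F Fx Fy" and H: "H = (\<lambda>x y. (x\<^sup>2 + y\<^sup>2) / 2 + F x y)"
  shows "trajectory_on (hamiltonian_field H) I \<gamma> \<longleftrightarrow> (\<forall>t\<in>I.
      ((\<lambda>t. fst (\<gamma> t)) has_real_derivative - (snd (\<gamma> t) + Fy (fst (\<gamma> t)) (snd (\<gamma> t)))) (at t within I) \<and>
      ((\<lambda>t. snd (\<gamma> t)) has_real_derivative fst (\<gamma> t) + Fx (fst (\<gamma> t)) (snd (\<gamma> t))) (at t within I))"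
proof -
  have field: "hamiltonian_field H (\<gamma> t) =
      (- (snd (\<gamma> t) + Fy (fst (\<gamma> t)) (snd (\<gamma> t))), fst (\<gamma> t) + Fx (fst (\<gamma> t)) (snd (\<gamma> t)))" for t
    unfolding H using hamiltonian_field_eq[OF F, of "fst (\<gamma> t)" "snd (\<gamma> t)"] by (simp only: prod.collapse)
  have "(\<gamma> has_vector_derivative (u, v)) (at t within I) \<longleftrightarrow>
      ((\<lambda>t. fst (\<gamma> t)) has_real_derivative u) (at t within I) \<and>
      ((\<lambda>t. snd (\<gamma> t)) has_real_derivative v) (at t within I)" for u v t
  proof
    assume *: "(\<gamma> has_vector_derivative (u, v)) (at t within I)"
    show "((\<lambda>t. fst (\<gamma> t)) has_real_derivative u) (at t within I) \<and>
      ((\<lambda>t. snd (\<gamma> t)) has_real_derivative v) (at t within I)"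
      using bounded_linear.has_vector_derivative[OF bounded_linear_fst *]
        bounded_linear.has_vector_derivative[OF bounded_linear_snd *]
      by (simp add: has_real_derivative_iff_has_vector_derivative)
  next
    assume "((\<lambda>t. fst (\<gamma> t)) has_real_derivative u) (at t within I) \<and>
      ((\<lambda>t. snd (\<gamma> t)) has_real_derivative v) (at t within I)"
    then have "((\<lambda>t. (fst (\<gamma> t), snd (\<gamma> t))) has_vector_derivative (u, v)) (at t within I)"
      unfolding has_real_derivative_iff_has_vector_derivative
      by (intro has_vector_derivative_Pair) auto
    then show "(\<gamma> has_vector_derivative (u, v)) (at t within I)" by simp
  qed
  then show ?thesis unfolding trajectory_on_def field by blast
qed

lemma hamiltonian_conserved:
  assumes F: "homogeneous_poly d F" and H: "H = (\<lambda>x y. (x\<^sup>2 + y\<^sup>2) / 2 + F x y)"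
    and traj: "trajectory_on (hamiltonian_field H) {0..T} \<gamma>" and t: "t \<in> {0..T}"
  shows "H (fst (\<gamma> t)) (snd (\<gamma> t)) = H (fst (\<gamma> 0)) (snd (\<gamma> 0))"
proof -
  obtain Fx Fy where partials: "has_partials F Fx Fy"
    using homogeneous_poly_partials[OF F] by metis
  define x where "x = (\<lambda>t. fst (\<gamma> t))"
  define y where "y = (\<lambda>t. snd (\<gamma> t))"
  have "((\<lambda>t. H (x t) (y t)) has_real_derivative 0) (at t within {0..T})" if "t \<in> {0..T}" for t
  proof -
    have dx: "(x has_real_derivative - (y t + Fy (x t) (y t))) (at t within {0..T})"
      and dy: "(y has_real_derivative x t + Fx (x t) (y t)) (at t within {0..T})"
      using traj that unfolding trajectory_components[OF partials H] x_def y_def by auto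
    have "((\<lambda>t. ((x t)\<^sup>2 + (y t)\<^sup>2) / 2) has_real_derivative
        x t * - (y t + Fy (x t) (y t)) + y t * (x t + Fx (x t) (y t))) (at t within {0..T})"
      by (auto intro!: derivative_eq_intros dx dy)
    from DERIV_add[OF this has_partialsD[OF partials dx dy]] show ?thesis
      by (simp add: H algebra_simps)
  qed
  then obtain c where "\<forall>t\<in>{0..T}. H (x t) (y t) = c"
    using has_field_derivative_zero_constant[of "{0..T}" "\<lambda>t. H (x t) (y t)"] by auto
  then show ?thesis using t unfolding x_def y_def by (metis atLeastAtMost_iff order_refl order_trans)
qed

text \<open>A class closed under differentiation by construction: it provides a continuous second
  derivative of the profile without computing one.\<close>

inductive trig_poly :: "(real \<Rightarrow> real) \<Rightarrow> bool" where
  const: "trig_poly (\<lambda>_. c)"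
| cos: "trig_poly cos"
| sin: "trig_poly sin"
| add: "trig_poly f \<Longrightarrow> trig_poly g \<Longrightarrow> trig_poly (\<lambda>t. f t + g t)"
| mult: "trig_poly f \<Longrightarrow> trig_poly g \<Longrightarrow> trig_poly (\<lambda>t. f t * g t)"

lemma trig_poly_deriv:
  "trig_poly f \<Longrightarrow> \<exists>f'. trig_poly f' \<and> (\<forall>t. (f has_real_derivative f' t) (at t))"
proof (induction rule: trig_poly.induct)
  case (const c)
  show ?case by (intro exI[of _ "\<lambda>_. 0"] conjI trig_poly.const allI) simp
next
  case cos
  show ?case
    by (intro exI[of _ "\<lambda>t. (- 1) * sin t"] conjI trig_poly.intros) (auto intro!: derivative_eq_intros)
next
  case sin
  show ?case
    by (intro exI[of _ cos] conjI trig_poly.intros) (auto intro!: derivative_eq_intros)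
next
  case (add f g)
  then obtain f' g' where "trig_poly f'" "trig_poly g'"
      "\<forall>t. (f has_real_derivative f' t) (at t)" "\<forall>t. (g has_real_derivative g' t) (at t)" by blast
  then show ?case
    by (intro exI[of _ "\<lambda>t. f' t + g' t"] conjI trig_poly.intros) (auto intro!: derivative_eq_intros)
next
  case (mult f g)
  then obtain f' g' where "trig_poly f'" "trig_poly g'"
      "\<forall>t. (f has_real_derivative f' t) (at t)" "\<forall>t. (g has_real_derivative g' t) (at t)" by blast
  with mult.hyps show ?case
    by (intro exI[of _ "\<lambda>t. f' t * g t + g' t * f t"] conjI trig_poly.intros) (auto intro!: derivative_eq_intros)
qed

lemma continuous_on_trig_poly: "trig_poly f \<Longrightarrow> continuous_on A f"
  by (induction rule: trig_poly.induct) (intro continuous_intros; assumption)+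

definition profile :: "(real \<Rightarrow> real \<Rightarrow> real) \<Rightarrow> real \<Rightarrow> real" where
  "profile F t = F (cos t) (sin t)"

lemma trig_poly_profile:
  assumes "homogeneous_poly d F"
  shows "trig_poly (profile F)"
proof -
  obtain c where c: "F = (\<lambda>x y. \<Sum>i\<le>d. c i * x ^ i * y ^ (d - i))"
    using assms unfolding homogeneous_poly_def by blast
  have pow: "trig_poly (\<lambda>t. f t ^ k)" if "trig_poly f" for f k
    by (induction k) (auto intro: trig_poly.intros that)
  have sum: "trig_poly (\<lambda>t. \<Sum>i\<in>A. f i t)" if "finite A" "\<And>i. trig_poly (f i)" for f and A :: "nat set"
    using that(1) by (induction rule: finite_induct) (auto intro: trig_poly.intros that(2))
  show ?thesis
    unfolding profile_def[abs_def] c by (intro sum trig_poly.intros pow) auto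
qed

lemma profile_polar:
  assumes "homogeneous_poly d F"
  shows "F (r * cos t) (r * sin t) = r ^ d * profile F t"
  by (simp add: profile_def homogeneous_poly_scale[OF assms])

lemma profile_plus_pi:
  assumes "homogeneous_poly d F"
  shows "profile F (t + pi) = (- 1) ^ d * profile F t"
  using homogeneous_poly_scale[OF assms, of "- 1" "cos t" "sin t"] by (simp add: profile_def)

text \<open>Every point (x, 1) lies on a ray with angle in [0, pi]. If the profile vanished there,
  the polynomial F(x, 1) would vanish for all x, and with it all coefficients of the form.\<close>

lemma profile_nonzero:
  assumes "homogeneous_poly d F"
  shows "\<exists>t\<in>{0..pi}. profile F t \<noteq> 0"
proof (rule ccontr)
  assume "\<not> ?thesis"
  then have zero: "profile F t = 0" if "t \<in> {0..pi}" for t using that by blast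
  obtain c where c: "\<exists>i\<le>d. c i \<noteq> 0" "\<And>x y. F x y = (\<Sum>i\<le>d. c i * x ^ i * y ^ (d - i))"
    using assms unfolding homogeneous_poly_def by blast
  have "(\<Sum>i\<le>d. c i * x ^ i) = 0" for x
  proof -
    define r where "r = sqrt (x\<^sup>2 + 1)"
    have r: "r > 0" "r\<^sup>2 = x\<^sup>2 + 1" by (auto simp: r_def add_nonneg_pos)
    have "(x / r)\<^sup>2 + (1 / r)\<^sup>2 = (x\<^sup>2 + 1) / r\<^sup>2"
      by (simp add: power_divide add_divide_distrib)
    also have "\<dots> = 1" using r(1) by (simp flip: r(2))
    finally have "(x / r)\<^sup>2 + (1 / r)\<^sup>2 = 1" .
    then obtain t where t: "0 \<le> t" "t \<le> pi" "x / r = cos t" "1 / r = sin t"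
      using sincos_total_pi[of "1 / r" "x / r"] r(1) by auto
    have "F x 1 = F (r * cos t) (r * sin t)"
      using r(1) by (simp flip: t(3,4))
    also have "\<dots> = 0" by (simp add: profile_polar[OF assms] zero t)
    finally show ?thesis by (simp add: c(2))
  qed
  with c(1) show False
    using polyfun_eq_0[of c d] by auto
qed

lemma homogeneous_poly_axis:
  assumes "homogeneous_poly d F"
  shows "F x 0 = x ^ d * F 1 0"
  using homogeneous_poly_scale[OF assms, of x 1 0] by simp

section \<open>Half periods of arcs\<close>

context
  fixes N :: nat and F H :: "real \<Rightarrow> real \<Rightarrow> real" and M r0 p q T :: real and \<gamma> :: "real \<Rightarrow> real \<times> real"
  assumes N: "N \<ge> 1" and F: "homogeneous_poly (N + 2) F" and H: "H = (\<lambda>x y. (x\<^sup>2 + y\<^sup>2) / 2 + F x y)"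
    and M: "M > 0" "\<And>x y. \<bar>F x y\<bar> \<le> M * sqrt (x\<^sup>2 + y\<^sup>2) ^ (N + 2)"
    and r0: "r0 > 0" "4 * (real N + 2) * M * r0 ^ N \<le> 1" "2 * M * r0 ^ N \<le> - crit_level N"
    and p: "0 < p" "4 * p < r0"
    and T: "T > 0" and q: "q < 0"
    and traj: "trajectory_on (hamiltonian_field H) {0..T} \<gamma>"
    and ends: "\<gamma> 0 = (p, 0)" "\<gamma> T = (q, 0)"
    and above: "\<And>t. t \<in> {0<..<T} \<Longrightarrow> snd (\<gamma> t) > 0"
begin

text \<open>The first smallness condition on r0 keeps the perturbation below r^2 / 4 even after
  multiplication by N + 2. The bounds on H confine the arc to the disc of radius r0; the third keeps
  its angular speed positive.\<close>

lemma hamiltonian_bounds: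
  assumes "sqrt (x\<^sup>2 + y\<^sup>2) \<le> r0"
  shows "H x y \<le> x\<^sup>2 + y\<^sup>2" "(x\<^sup>2 + y\<^sup>2) / 4 \<le> H x y"
    and "(real N + 2) * \<bar>F x y\<bar> \<le> (x\<^sup>2 + y\<^sup>2) / 4"
proof -
  let ?R = "sqrt (x\<^sup>2 + y\<^sup>2)"
  have "(real N + 2) * \<bar>F x y\<bar> \<le> (real N + 2) * (M * ?R ^ (N + 2))"
    using M(2) by (intro mult_left_mono) auto
  also have "\<dots> = (real N + 2) * M * ?R ^ N * (x\<^sup>2 + y\<^sup>2)"
    by (simp add: power_add mult_ac)
  also have "\<dots> \<le> (real N + 2) * M * r0 ^ N * (x\<^sup>2 + y\<^sup>2)"
    using M assms by (intro mult_right_mono mult_left_mono power_mono) auto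
  also have "\<dots> \<le> 1 / 4 * (x\<^sup>2 + y\<^sup>2)"
    using r0(2) by (intro mult_right_mono) (auto simp: algebra_simps)
  finally show *: "(real N + 2) * \<bar>F x y\<bar> \<le> (x\<^sup>2 + y\<^sup>2) / 4" by simp
  have "1 * \<bar>F x y\<bar> \<le> (real N + 2) * \<bar>F x y\<bar>" by (intro mult_right_mono) auto
  with * have "\<bar>F x y\<bar> \<le> (x\<^sup>2 + y\<^sup>2) / 4" by linarith
  then have "- ((x\<^sup>2 + y\<^sup>2) / 4) \<le> F x y \<and> F x y \<le> (x\<^sup>2 + y\<^sup>2) / 4" by linarith
  then show "H x y \<le> x\<^sup>2 + y\<^sup>2" "(x\<^sup>2 + y\<^sup>2) / 4 \<le> H x y"
    unfolding H by (auto simp: field_simps)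
qed

lemma arc_half_period:
  "H p 0 = H q 0 \<and> \<bar>q\<bar> \<le> 2 * p \<and> H p 0 > 0 \<and> T = half_period N (profile F) (sqrt (2 * H p 0) ^ N)"
proof -
  define x where "x = (\<lambda>t. fst (\<gamma> t))"
  define y where "y = (\<lambda>t. snd (\<gamma> t))"
  obtain Fx Fy where partials: "has_partials F Fx Fy"
    and euler: "\<And>x y. x * Fx x y + y * Fy x y = real (N + 2) * F x y"
    using homogeneous_poly_partials[OF F] by metis
  define x' where "x' = (\<lambda>t. - (y t + Fy (x t) (y t)))"
  define y' where "y' = (\<lambda>t. x t + Fx (x t) (y t))"
  have dx: "(x has_real_derivative x' t) (at t within {0..T})"
    and dy: "(y has_real_derivative y' t) (at t within {0..T})" if "t \<in> {0..T}" for t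
    using traj that unfolding trajectory_components[OF partials H] x_def y_def x'_def y'_def by auto
  have x0: "x 0 = p" "y 0 = 0" "x T = q" "y T = 0" using ends by (auto simp: x_def y_def)
  have y_nonneg: "y t \<ge> 0" if "t \<in> {0..T}" for t
    using above[of t] x0 that by (cases "t = 0"; cases "t = T") (auto simp: y_def)
  have energy: "H (x t) (y t) = H p 0" if "t \<in> {0..T}" for t
    using hamiltonian_conserved[OF F H traj that] ends by (simp add: x_def y_def)
  define R where "R = (\<lambda>t. sqrt ((x t)\<^sup>2 + (y t)\<^sup>2))"
  have Rsq: "(R t)\<^sup>2 = (x t)\<^sup>2 + (y t)\<^sup>2" for t by (simp add: R_def)
  have contx: "continuous_on {0..T} x" by (rule DERIV_continuous_on[OF dx])
  have conty: "continuous_on {0..T} y" by (rule DERIV_continuous_on[OF dy])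
  have contR: "continuous_on {0..T} R"
    unfolding R_def by (intro continuous_intros contx conty)
  have Hp: "H p 0 \<le> p\<^sup>2" "p\<^sup>2 / 4 \<le> H p 0"
    using hamiltonian_bounds(1,2)[of p 0] p by auto
  have Hp_pos: "H p 0 > 0" using Hp(2) p by (smt (verit) divide_pos_pos zero_less_power)
  \<comment> \<open>Reaching radius r0 would require energy at least r0^2 / 4, but the energy is at
    most p^2 < (r0 / 2)^2.\<close>
  have R_less: "R t < r0" if t: "t \<in> {0..T}" for t
  proof (rule ccontr)
    assume "\<not> R t < r0"
    then obtain t1 where t1: "0 \<le> t1" "t1 \<le> t" "R t1 = r0"
      using IVT'[of R 0 r0 t] t p x0 continuous_on_subset[OF contR, of "{0..t}"] by (auto simp: R_def)
    then have t1T: "t1 \<in> {0..T}" using t by auto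
    have "r0\<^sup>2 / 4 \<le> H (x t1) (y t1)"
      using hamiltonian_bounds(2)[of "x t1" "y t1"] t1(3) Rsq[of t1] by (simp add: R_def)
    also have "\<dots> \<le> p\<^sup>2" using energy[OF t1T] Hp by simp
    also have "\<dots> < (r0 / 2)\<^sup>2" using p by (intro power_strict_mono) auto
    finally show False by (simp add: power_divide)
  qed
  have R_pos: "R t > 0" if t: "t \<in> {0..T}" for t
  proof -
    have "0 < H (x t) (y t)" using energy[OF t] Hp_pos by simp
    also have "\<dots> \<le> (R t)\<^sup>2"
      using hamiltonian_bounds(1)[of "x t" "y t"] R_less[OF t] by (simp add: R_def)
    finally show ?thesis by (simp add: R_def less_le)
  qed
  have energy_q: "H q 0 = H p 0" using energy[of T] T x0 by simp
  have "q\<^sup>2 / 4 \<le> p\<^sup>2"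
    using hamiltonian_bounds(2)[of q 0] R_less[of T] T x0 energy_q Hp(1) by (simp add: R_def)
  then have "\<bar>q\<bar>\<^sup>2 \<le> (2 * p)\<^sup>2" by (simp add: power_mult_distrib)
  then have q_le: "\<bar>q\<bar> \<le> 2 * p" by (rule power2_le_imp_le) (use p in simp)

  \<comment> \<open>Rotating by a quarter turn puts the closed upper half plane into the domain of the principal
    logarithm, so that the polar angle is differentiable up to both ends of the arc.\<close>
  define w where "w = (\<lambda>t. Complex (y t) (- x t))"
  define \<theta> where "\<theta> = (\<lambda>t. pi / 2 + Im (Ln (w t)))"
  define \<omega> where "\<omega> = (\<lambda>t. 1 + (real N + 2) * F (x t) (y t) / (R t)\<^sup>2)"
  have w_nz: "w t \<noteq> 0" and w_dom: "w t \<notin> \<real>\<^sub>\<le>\<^sub>0" if "t \<in> {0..T}" for t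
    using R_pos[OF that] y_nonneg[OF that]
    by (auto simp: w_def R_def complex_eq_iff complex_nonpos_Reals_iff)
  have norm_w: "cmod (w t) = R t" for t
    by (simp add: w_def R_def cmod_def add.commute)
  have dw: "(w has_vector_derivative Complex (y' t) (- x' t)) (at t within {0..T})" if "t \<in> {0..T}" for t
  proof -
    have "((\<lambda>t. of_real (y t) + \<i> * of_real (- x t)) has_vector_derivative of_real (y' t) + \<i> * of_real (- x' t))
        (at t within {0..T})"
      using dx[OF that] dy[OF that]
      by (intro has_vector_derivative_add has_vector_derivative_mult_right has_vector_derivative_of_real
            DERIV_minus)
    then show ?thesis by (simp only: w_def Complex_eq)
  qed
  have d\<theta>: "(\<theta> has_real_derivative \<omega> t) (at t within {0..T})" if t: "t \<in> {0..T}" for t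
  proof -
    have "(Ln \<circ> w has_vector_derivative Complex (y' t) (- x' t) * inverse (w t)) (at t within {0..T})"
      by (rule field_vector_diff_chain_within[OF dw[OF t]
            has_field_derivative_at_within[OF has_field_derivative_Ln[OF w_dom[OF t]]]])
    from bounded_linear.has_vector_derivative[OF bounded_linear_Im this]
    have "((\<lambda>t. Im (Ln (w t))) has_real_derivative Im (Complex (y' t) (- x' t) * inverse (w t))) (at t within {0..T})"
      by (simp add: has_real_derivative_iff_has_vector_derivative)
    moreover have "Im (Complex (y' t) (- x' t) * inverse (w t)) = (x t * y' t - y t * x' t) / (R t)\<^sup>2"
      by (simp add: w_def Rsq inverse_complex.code diff_divide_distrib add.commute mult_ac)
    moreover have "\<dots> = \<omega> t"
    proof -
      have "x t * y' t - y t * x' t = (R t)\<^sup>2 + (x t * Fx (x t) (y t) + y t * Fy (x t) (y t))"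
        unfolding Rsq x'_def y'_def by (simp add: algebra_simps power2_eq_square)
      then show ?thesis using R_pos[OF t] by (simp add: \<omega>_def euler add_divide_distrib)
    qed
    ultimately have "((\<lambda>t. Im (Ln (w t))) has_real_derivative \<omega> t) (at t within {0..T})" by (simp only:)
    from DERIV_add[OF DERIV_const[of "pi / 2"] this] show ?thesis by (simp add: \<theta>_def)
  qed
  have xy: "x t = R t * cos (\<theta> t)" "y t = R t * sin (\<theta> t)" if t: "t \<in> {0..T}" for t
  proof -
    have "exp (Ln (w t)) = w t" by (rule exp_Ln[OF w_nz[OF t]])
    then have "exp (Re (Ln (w t))) * cos (Im (Ln (w t))) = y t" "exp (Re (Ln (w t))) * sin (Im (Ln (w t))) = - x t"
      by (simp_all add: complex_eq_iff Re_exp Im_exp w_def)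
    moreover have "exp (Re (Ln (w t))) = R t"
      using w_nz[OF t] R_pos[OF t] by (simp add: norm_w)
    ultimately show "x t = R t * cos (\<theta> t)" "y t = R t * sin (\<theta> t)"
      by (simp_all add: \<theta>_def cos_add sin_add)
  qed
  have \<theta>_range: "\<theta> t \<in> {0..pi}" if t: "t \<in> {0..T}" for t
    using Re_Ln_pos_le[OF w_nz[OF t]] y_nonneg[OF t] by (auto simp: \<theta>_def w_def abs_le_iff)
  have \<theta>_0: "\<theta> 0 = 0"
  proof -
    have "w 0 = of_real p * - \<i>" by (simp add: w_def x0 complex_eq_iff)
    moreover have "Ln (of_real p * - \<i>) = Ln (of_real p) + Ln (- \<i>)"
      by (rule Ln_times_of_real[OF p(1)]) simp
    ultimately have "Ln (w 0) = Ln (of_real p) + Ln (- \<i>)" by (simp only:)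
    then show ?thesis by (simp add: \<theta>_def Ln_of_real[OF p(1)])
  qed
  have \<theta>_T: "\<theta> T = pi"
  proof -
    have "w T = of_real (- q) * \<i>" by (simp add: w_def x0 complex_eq_iff)
    then show ?thesis using q by (simp add: \<theta>_def Ln_times_of_real del: of_real_minus mult_minus_left)
  qed

  define s where "s = sqrt (2 * H p 0)"
  have s: "s > 0" "s\<^sup>2 = 2 * H p 0" using Hp_pos by (auto simp: s_def)
  have "s\<^sup>2 \<le> (2 * p)\<^sup>2" using s(2) Hp(1) Hp_pos by (simp add: power_mult_distrib)
  then have "s \<le> 2 * p" by (rule power2_le_imp_le) (use p in simp)
  then have s_le: "s \<le> r0" using p by simp
  \<comment> \<open>This is the second smallness condition on r0, used with s <= r0; its factor 2
    yields the strict inequality.\<close>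
  have crit: "crit_level N < s ^ N * profile F t" for t
  proof -
    have "\<bar>profile F t\<bar> \<le> M" using M(2)[of "cos t" "sin t"] by (simp add: profile_def)
    then have "s ^ N * (- M) \<le> s ^ N * profile F t" using s by (intro mult_left_mono) auto
    moreover have "s ^ N * M \<le> r0 ^ N * M" using s s_le M by (intro mult_right_mono power_mono) auto
    ultimately show ?thesis using r0(3) crit_level_neg[OF N] by (simp add: mult_ac)
  qed
  have density: "\<omega> t * time_density N (s ^ N * profile F (\<theta> t)) = 1" if t: "t \<in> {0..T}" for t
  proof -
    note R = R_pos[OF t]
    define u where "u = R t / s"
    have u: "u > 0" using R s by (simp add: u_def)
    have Ft: "F (x t) (y t) = R t ^ (N + 2) * profile F (\<theta> t)"
      unfolding xy[OF t] by (rule profile_polar[OF F])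
    have s2: "s\<^sup>2 = (R t)\<^sup>2 + 2 * F (x t) (y t)"
    proof -
      have "s\<^sup>2 = 2 * H (x t) (y t)" by (simp only: energy[OF t] s(2))
      then show ?thesis by (simp add: H Rsq)
    qed
    have "level N u = s ^ N * profile F (\<theta> t)"
    proof -
      have "level N u = (1 - (R t)\<^sup>2 / s\<^sup>2) / (2 * (R t ^ (N + 2) / (s ^ N * s\<^sup>2)))"
        by (simp add: level_def u_def power_divide power_add power2_eq_square)
      also have "\<dots> = s ^ N * (s\<^sup>2 - (R t)\<^sup>2) / (2 * R t ^ (N + 2))"
        using s(1) R by (simp add: field_simps)
      also have "\<dots> = s ^ N * profile F (\<theta> t)"
        using R unfolding s2 Ft by simp
      finally show ?thesis .
    qed
    moreover have "angular_speed N u = \<omega> t"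
    proof -
      have "angular_speed N u = ((real N + 2) * s\<^sup>2 - real N * (R t)\<^sup>2) / (2 * (R t)\<^sup>2)"
        using s(1) R by (simp add: angular_speed_def u_def field_simps)
      also have "\<dots> = \<omega> t"
        using R unfolding s2 \<omega>_def by (simp add: field_simps)
      finally show ?thesis .
    qed
    \<comment> \<open>A positive speed puts u below the critical radius, hence on the branch where
      \<open>orbit_radius\<close> inverts \<open>level\<close>.\<close>
    moreover have "\<omega> t > 0"
    proof -
      have "(real N + 2) * \<bar>F (x t) (y t)\<bar> \<le> (R t)\<^sup>2 / 4"
        using hamiltonian_bounds(3)[of "x t" "y t"] R_less[OF t] by (simp add: Rsq R_def)
      moreover have "- ((real N + 2) * \<bar>F (x t) (y t)\<bar>) \<le> (real N + 2) * F (x t) (y t)"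
        using abs_le_iff[of "F (x t) (y t)"] mult_left_mono[of "- \<bar>F (x t) (y t)\<bar>" "F (x t) (y t)" "real N + 2"] by auto
      moreover have "(R t)\<^sup>2 > 0" using R by simp
      ultimately have "0 < (R t)\<^sup>2 + (real N + 2) * F (x t) (y t)" by linarith
      then have "0 < ((R t)\<^sup>2 + (real N + 2) * F (x t) (y t)) / (R t)\<^sup>2" using R by simp
      then show ?thesis using R by (simp add: \<omega>_def add_divide_distrib)
    qed
    ultimately show ?thesis
      using orbit_radius_level[OF N u angular_speed_pos_imp[OF N u]] by (simp add: time_density_def)
  qed
  have contf: "continuous_on UNIV (profile F)"
    by (intro continuous_on_trig_poly trig_poly_profile[OF F])
  \<comment> \<open>By \<open>density\<close> the integrand is 1 along the arc, so the integral over
    time is T; substituting the polar angle turns it into an integral over [0, pi].\<close>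
  have "((\<lambda>t. \<omega> t *\<^sub>R time_density N (s ^ N * profile F (\<theta> t))) has_integral
      integral {\<theta> 0..\<theta> T} (\<lambda>t. time_density N (s ^ N * profile F t))) {0..T}"
  proof (rule has_integral_substitution[where c = 0 and d = pi])
    show "continuous_on {0..pi} (\<lambda>t. time_density N (s ^ N * profile F t))"
      using crit by (intro continuous_on_time_density[OF N contf])
  qed (use T \<theta>_range \<theta>_0 \<theta>_T d\<theta> in auto)
  then have "((\<lambda>t. 1) has_integral half_period N (profile F) (s ^ N)) {0..T}"
    unfolding \<theta>_0 \<theta>_T half_period_def by (rule has_integral_eq[rotated]) (use density in simp)
  then have "T = half_period N (profile F) (s ^ N)"
    using has_integral_unique[OF has_integral_const_real[of "1::real" 0 T]] T by simp
  then show ?thesis using energy_q q_le Hp_pos by (simp add: s_def)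
qed

end

lemma upper_arc_half_period:
  assumes N: "N \<ge> 1" and F: "homogeneous_poly (N + 2) F" and H: "H = (\<lambda>x y. (x\<^sup>2 + y\<^sup>2) / 2 + F x y)"
  obtains \<delta> where "\<delta> > 0" "\<And>p q T. 0 < p \<Longrightarrow> p < \<delta> \<Longrightarrow> upper_arc (hamiltonian_field H) p q T \<Longrightarrow>
      H p 0 = H q 0 \<and> \<bar>q\<bar> \<le> 2 * p \<and> H p 0 > 0 \<and> T = half_period N (profile F) (sqrt (2 * H p 0) ^ N)"
proof -
  obtain M where M: "M > 0" "\<And>x y. \<bar>F x y\<bar> \<le> M * sqrt (x\<^sup>2 + y\<^sup>2) ^ (N + 2)"
    using homogeneous_poly_bound[OF F] by blast
  \<comment> \<open>The largest value of r0^N that both smallness conditions allow.\<close>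
  define \<kappa> where "\<kappa> = min (1 / (4 * (real N + 2) * M)) (- crit_level N / (2 * M))"
  have \<kappa>: "\<kappa> > 0" using M crit_level_neg[OF N] by (simp add: \<kappa>_def divide_neg_pos)
  define r0 where "r0 = root N \<kappa>"
  have r0: "r0 > 0" "r0 ^ N = \<kappa>" using N \<kappa> by (auto simp: r0_def)
  have "4 * (real N + 2) * M * \<kappa> \<le> 4 * (real N + 2) * M * (1 / (4 * (real N + 2) * M))"
    using M by (intro mult_left_mono) (auto simp: \<kappa>_def)
  then have 1: "4 * (real N + 2) * M * r0 ^ N \<le> 1" using M r0(2) by simp
  have "2 * M * \<kappa> \<le> 2 * M * (- crit_level N / (2 * M))"
    using M by (intro mult_left_mono) (auto simp: \<kappa>_def)
  then have 2: "2 * M * r0 ^ N \<le> - crit_level N" using M r0(2) by simp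
  show thesis
  proof (rule that[of "r0 / 4"])
    fix p q T assume p: "0 < p" "p < r0 / 4" and "upper_arc (hamiltonian_field H) p q T"
    then obtain \<gamma> where "T > 0" "q < 0" "trajectory_on (hamiltonian_field H) {0..T} \<gamma>"
        "\<gamma> 0 = (p, 0)" "\<gamma> T = (q, 0)" "\<And>t. t \<in> {0<..<T} \<Longrightarrow> snd (\<gamma> t) > 0"
      unfolding upper_arc_def by blast
    with p show "H p 0 = H q 0 \<and> \<bar>q\<bar> \<le> 2 * p \<and> H p 0 > 0 \<and> T = half_period N (profile F) (sqrt (2 * H p 0) ^ N)"
      by (intro arc_half_period[OF N F H M r0(1) 1 2, where \<gamma> = \<gamma>]) auto
  qed (use r0 in auto)
qed

section \<open>Dichotomy for half periods\<close>

definition bounded_by_pi :: "(real \<Rightarrow> real) \<Rightarrow> bool" where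
  "bounded_by_pi \<tau> \<longleftrightarrow> (\<forall>P. analytic_below \<tau> P) \<and> (\<forall>p\<ge>0. 0 \<le> \<tau> p \<and> \<tau> p \<le> pi)"

definition blows_up :: "(real \<Rightarrow> real) \<Rightarrow> real \<Rightarrow> bool" where
  "blows_up \<tau> P \<longleftrightarrow> P > 0 \<and> analytic_below \<tau> P \<and> (\<forall>p\<in>{0..<P}. 0 \<le> \<tau> p) \<and> filterlim \<tau> at_top (at_left P)"

lemma blows_up_sum_not_const:
  assumes "blows_up \<tau> P" "analytic_below \<sigma> P" "\<And>p. p \<in> {0..<P} \<Longrightarrow> 0 \<le> \<sigma> p"
    and "\<forall>\<^sub>F p in at_right 0. \<sigma> p + \<tau> p = c"
  shows False
proof -
  have P: "P > 0" "analytic_below \<tau> P" "filterlim \<tau> at_top (at_left P)"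
    using assms(1) by (auto simp: blows_up_def)
  have "\<sigma> p + \<tau> p = c" if "p \<in> {0..<P}" for p
    by (rule analytic_below_eq_const[OF analytic_below_add[OF assms(2) P(2)] P(1) assms(4) that])
  then have "\<tau> p \<le> c" if "p \<in> {0..<P}" for p
    using assms(3)[OF that] that by force
  then have "\<forall>\<^sub>F p in at_left P. \<tau> p \<le> c"
    using eventually_at_left_real[OF P(1)] by (auto elim: eventually_mono)
  moreover have "\<forall>\<^sub>F p in at_left P. c + 1 \<le> \<tau> p"
    using P(3) by (simp add: filterlim_at_top)
  ultimately have "\<forall>\<^sub>F p in at_left P. False"
    by eventually_elim simp
  then show False by simp
qed

text \<open>Strict inequality is asked of one summand only, so that the constant pi may stand in for
  a linear half. If neither summand diverges, the values at 0 force c = 2 pi.\<close>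

lemma sum_not_const:
  assumes \<sigma>: "bounded_by_pi \<sigma> \<or> (\<exists>P. blows_up \<sigma> P)" and \<tau>: "bounded_by_pi \<tau> \<and> (\<forall>p>0. \<tau> p < pi) \<or> (\<exists>P. blows_up \<tau> P)"
    and zero: "\<sigma> 0 = pi" "\<tau> 0 = pi"
    and const: "\<forall>\<^sub>F p in at_right 0. \<sigma> p + \<tau> p = c"
  shows False
proof -
  have const': "\<forall>\<^sub>F p in at_right 0. \<tau> p + \<sigma> p = c" using const by (simp add: add.commute)
  consider (both) "bounded_by_pi \<sigma>" "bounded_by_pi \<tau>" "\<forall>p>0. \<tau> p < pi"
    | (left) P where "blows_up \<sigma> P" "bounded_by_pi \<tau>"
    | (right) P where "bounded_by_pi \<sigma>" "blows_up \<tau> P"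
    | (none) P Q where "blows_up \<sigma> P" "blows_up \<tau> Q"
    using \<sigma> \<tau> by blast
  then show False
  proof cases
    case both
    then have an: "analytic_below (\<lambda>p. \<sigma> p + \<tau> p) 1"
      by (intro analytic_below_add) (auto simp: bounded_by_pi_def)
    have "\<sigma> 0 + \<tau> 0 = c" by (rule analytic_below_eq_const[OF an _ const]) auto
    then have c: "c = 2 * pi" using zero by simp
    have "\<forall>\<^sub>F p::real in at_right 0. False"
      using const eventually_at_right_less[of 0]
    proof eventually_elim
      case (elim p)
      then show False using both(1,3) c unfolding bounded_by_pi_def by (smt (verit))
    qed
    then show False by simp
  next
    case left
    then show False
      by (intro blows_up_sum_not_const[OF _ _ _ const']) (auto simp: bounded_by_pi_def)
  next
    case right
    then show False
      by (intro blows_up_sum_not_const[OF _ _ _ const]) (auto simp: bounded_by_pi_def)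
  next
    case none
    show False
    \<comment> \<open>The nearer singularity decides: up to it the other half period is still
      analytic and nonnegative.\<close>
    proof (cases "P \<le> Q")
      case True
      then show False using none
        by (intro blows_up_sum_not_const[OF none(1) _ _ const'])
           (auto simp: blows_up_def intro: analytic_below_mono)
    next
      case False
      then show False using none
        by (intro blows_up_sum_not_const[OF none(2) _ _ const])
           (auto simp: blows_up_def intro: analytic_below_mono)
    qed
  qed
qed

lemma continuous_on_profile: "homogeneous_poly d F \<Longrightarrow> continuous_on UNIV (profile F)"
  by (intro continuous_on_trig_poly trig_poly_profile)

text \<open>The minimum is critical even if it is found at an endpoint of [0, pi]: for even d the
  profile has period pi, so the minimum is global on the line. If the form vanishes on the axis, the
  profile is 0 at both ends and a negative minimum is interior. Two mean value estimates with a
  bound on the second derivative then give the parabola.\<close>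

lemma profile_quadratic_minimum:
  assumes F: "homogeneous_poly d F" and s: "s \<in> {0..pi}"
    and min: "\<And>t. t \<in> {0..pi} \<Longrightarrow> profile F s \<le> profile F t" and neg: "profile F s < 0"
    and d: "even d \<or> F 1 0 = 0"
  obtains K where "K > 0" "\<And>t. t \<in> {0..pi} \<Longrightarrow> profile F t \<le> profile F s + K * (t - s)\<^sup>2"
proof -
  let ?f = "profile F"
  obtain f' where f': "trig_poly f'" "\<And>t. (?f has_real_derivative f' t) (at t)"
    using trig_poly_deriv[OF trig_poly_profile[OF F]] by blast
  obtain f'' where f'': "trig_poly f''" "\<And>t. (f' has_real_derivative f'' t) (at t)"
    using trig_poly_deriv[OF f'(1)] by blast
  have "f' s = 0"
    using d
  proof
    assume "even d"
    then have per: "?f (t + pi) = ?f t" for t using profile_plus_pi[OF F, of t] by simp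
    have "?f s \<le> ?f t" if "\<bar>s - t\<bar> < pi" for t
    proof -
      have "t \<in> {0..pi} \<or> t + pi \<in> {0..pi} \<or> t - pi \<in> {0..pi}" using s that by auto
      then show ?thesis using min[of t] min[of "t + pi"] min[of "t - pi"] per[of t] per[of "t - pi"] by auto
    qed
    then show ?thesis
      by (intro DERIV_local_min[OF f'(2) pi_gt_zero]) auto
  next
    assume "F 1 0 = 0"
    then have "?f 0 = 0" "?f pi = 0"
      using homogeneous_poly_axis[OF F, of "- 1"] by (auto simp: profile_def)
    then have "s \<noteq> 0" "s \<noteq> pi" using neg by auto
    then have s': "0 < min s (pi - s)" using s by auto
    show ?thesis
    proof (rule DERIV_local_min[OF f'(2) s'], intro allI impI)
      fix t assume "\<bar>s - t\<bar> < min s (pi - s)"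
      then show "?f s \<le> ?f t" by (intro min) auto
    qed
  qed
  have "continuous_on {0..pi} f''"
    by (rule continuous_on_trig_poly[OF f''(1)])
  then have "bounded (f'' ` {0..pi})"
    by (intro compact_imp_bounded compact_continuous_image) auto
  then obtain K where K: "K > 0" "\<And>t. t \<in> {0..pi} \<Longrightarrow> norm (f'' t) \<le> K"
    unfolding bounded_pos by auto
  have 1: "\<bar>f' t\<bar> \<le> K * \<bar>t - s\<bar>" if t: "t \<in> {0..pi}" for t
    using field_differentiable_bound[of "{0..pi}" f' f'' K t s] K(2) t s \<open>f' s = 0\<close>
    by (auto intro: has_field_derivative_at_within f''(2))
  have "?f t \<le> ?f s + K * (t - s)\<^sup>2" if t: "t \<in> {0..pi}" for t
  proof -
    have "norm (?f t - ?f s) \<le> (K * \<bar>t - s\<bar>) * norm (t - s)"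
    proof (rule field_differentiable_bound[of "closed_segment s t" ?f f'])
      show "(?f has_real_derivative f' z) (at z within closed_segment s t)" for z
        by (rule has_field_derivative_at_within[OF f'(2)])
      fix z assume z: "z \<in> closed_segment s t"
      then have "z \<in> {0..pi}" "\<bar>z - s\<bar> \<le> \<bar>t - s\<bar>"
        using s t by (auto simp: closed_segment_eq_real_ivl split: if_splits)
      then show "norm (f' z) \<le> K * \<bar>t - s\<bar>"
        using 1[of z] K(1) by (smt (verit) mult_left_mono real_norm_def)
    qed auto
    also have "\<dots> = K * (t - s)\<^sup>2" by (simp add: power2_eq_square)
    finally show ?thesis by (simp add: abs_le_iff)
  qed
  with K(1) show thesis by (rule that)
qed

lemma half_period_dichotomy:
  assumes N: "N \<ge> 1" and F: "homogeneous_poly (N + 2) F" and a: "even N \<or> F 1 0 = 0"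
  defines "\<tau> \<equiv> \<lambda>p. half_period N (profile F) (energy_param N (F 1 0) p)"
  shows "\<tau> 0 = pi" and "bounded_by_pi \<tau> \<and> (\<forall>p>0. \<tau> p < pi) \<or> (\<exists>P. blows_up \<tau> P)"
proof -
  let ?f = "profile F" and ?a = "F 1 0"
  note f = continuous_on_profile[OF F]
  have e0: "energy_param N ?a 0 = 0" using N by (simp add: energy_param_def)
  show \<tau>0: "\<tau> 0 = pi" by (simp add: \<tau>_def e0 half_period_0[OF N f])
  have fa: "?f 0 = ?a" by (simp add: profile_def)
  have "\<exists>s\<in>{0..pi}. \<forall>t\<in>{0..pi}. ?f s \<le> ?f t"
    by (intro continuous_attains_inf continuous_on_subset[OF f]) auto
  then obtain s where s: "s \<in> {0..pi}" "\<And>t. t \<in> {0..pi} \<Longrightarrow> ?f s \<le> ?f t" by blast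
  show "bounded_by_pi \<tau> \<and> (\<forall>p>0. \<tau> p < pi) \<or> (\<exists>P. blows_up \<tau> P)"
  proof (cases "?f s \<ge> 0")
    case True
    then have nonneg: "0 \<le> ?f t" if "t \<in> {0..pi}" for t using s(2)[OF that] by simp
    then have a0: "0 \<le> ?a" using fa by force
    have e: "0 \<le> energy_param N ?a p" if "0 \<le> p" for p
      using that a0 by (simp add: energy_param_def)
    have epos: "0 < energy_param N ?a p" if "0 < p" for p
      using that a0 unfolding energy_param_def
      by (intro mult_pos_pos zero_less_power add_pos_nonneg mult_nonneg_nonneg) auto
    have crit: "crit_level N < energy_param N ?a p * ?f t" if "0 \<le> p" "t \<in> {0..pi}" for p t
      using crit_level_neg[OF N] e[OF that(1)] nonneg[OF that(2)]
      by (meson less_le_trans mult_nonneg_nonneg)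
    obtain u where u: "u \<in> {0..pi}" "?f u \<noteq> 0" using profile_nonzero[OF F] by blast
    have lt: "\<tau> p < pi" if "p > 0" for p
      unfolding \<tau>_def by (rule half_period_less_pi[OF N f epos[OF that] nonneg u])
    have "bounded_by_pi \<tau>"
      unfolding bounded_by_pi_def
    proof (intro conjI allI impI)
      show "analytic_below \<tau> P" for P
        unfolding \<tau>_def by (rule analytic_below_half_period[OF N f]) (use crit in auto)
      show "0 \<le> \<tau> p" if "p \<ge> 0" for p
        unfolding \<tau>_def by (rule half_period_nonneg[OF N f crit[OF that]])
      show "\<tau> p \<le> pi" if "p \<ge> 0" for p
        using lt[of p] \<tau>0 that by (cases "p = 0") auto
    qed
    with lt show ?thesis by blast
  next
    case False
    then have neg: "?f s < 0" by simp
    define \<mu> where "\<mu> = - ?f s"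
    have \<mu>: "\<mu> > 0" "- \<mu> \<le> ?a" using neg s(2)[of 0] fa by (auto simp: \<mu>_def)
    obtain P where P: "P > 0" "energy_param N ?a P * \<mu> = - crit_level N"
      "\<And>p. p \<in> {0..<P} \<Longrightarrow> 0 \<le> energy_param N ?a p \<and> energy_param N ?a p * \<mu> < - crit_level N"
      using energy_param_reaches_crit[OF N \<mu> a] by blast
    obtain K where K: "K > 0" "\<And>t. t \<in> {0..pi} \<Longrightarrow> ?f t \<le> - \<mu> + K * (t - s)\<^sup>2"
      using profile_quadratic_minimum[OF F s neg] a unfolding \<mu>_def by auto
    have crit: "crit_level N < energy_param N ?a p * ?f t" if "p \<in> {0..<P}" "t \<in> {0..pi}" for p t
    proof -
      have "energy_param N ?a p * (- \<mu>) \<le> energy_param N ?a p * ?f t"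
        using P(3)[OF that(1)] s(2)[OF that(2)] by (intro mult_left_mono) (auto simp: \<mu>_def)
      then show ?thesis using P(3)[OF that(1)] by simp
    qed
    have top: "filterlim (half_period N ?f) at_top (at_left (- crit_level N / \<mu>))"
      by (rule half_period_at_top[OF N f \<mu>(1) K(1) _ s(1) K(2)]) (use s(2) in \<open>auto simp: \<mu>_def\<close>)
    have eP: "energy_param N ?a P = - crit_level N / \<mu>"
    proof -
      have "energy_param N ?a P * \<mu> / \<mu> = - crit_level N / \<mu>" by (simp only: P(2))
      then show ?thesis using \<mu>(1) by simp
    qed
    have "filterlim (energy_param N ?a) (at_left (- crit_level N / \<mu>)) (at_left P)"
      unfolding filterlim_at
    proof
      show "(energy_param N ?a \<longlongrightarrow> - crit_level N / \<mu>) (at_left P)"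
        unfolding eP[symmetric] energy_param_def by (intro tendsto_intros)
      show "\<forall>\<^sub>F p in at_left P. energy_param N ?a p \<in> {..<- crit_level N / \<mu>} \<and> energy_param N ?a p \<noteq> - crit_level N / \<mu>"
        using eventually_at_left_real[OF P(1)]
      proof eventually_elim
        case (elim p)
        then have "energy_param N ?a p < - crit_level N / \<mu>"
          using P(3)[of p] unfolding pos_less_divide_eq[OF \<mu>(1)] by auto
        then show ?case by auto
      qed
    qed
    then have lim: "filterlim \<tau> at_top (at_left P)"
      unfolding \<tau>_def by (rule filterlim_compose[OF top])
    have "blows_up \<tau> P"
      unfolding blows_up_def
    proof (intro conjI ballI)
      show "analytic_below \<tau> P"
        unfolding \<tau>_def by (rule analytic_below_half_period[OF N f crit])
      show "0 \<le> \<tau> p" if "p \<in> {0..<P}" for p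
        unfolding \<tau>_def by (rule half_period_nonneg[OF N f crit[OF that]])
    qed (use P lim in auto)
    then show ?thesis by blast
  qed
qed

text \<open>Twice the energy is p^2 (1 + 2 a p^N) with a = \<open>F 1 0\<close>. For even N the N-th
  power removes the square root, and for a = 0 the root is p itself.\<close>

lemma energy_param_eq:
  assumes F: "homogeneous_poly (N + 2) F" and a: "even N \<or> F 1 0 = 0"
    and p: "p > 0" and H: "(p\<^sup>2 + 0\<^sup>2) / 2 + F p 0 > 0"
  shows "sqrt (2 * ((p\<^sup>2 + 0\<^sup>2) / 2 + F p 0)) ^ N = energy_param N (F 1 0) p"
proof -
  have eq: "2 * ((p\<^sup>2 + 0\<^sup>2) / 2 + F p 0) = p\<^sup>2 * (1 + 2 * F 1 0 * p ^ N)"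
    by (simp add: homogeneous_poly_axis[OF F, of p] power_add power2_eq_square algebra_simps)
  show ?thesis
  proof (cases "F 1 0 = 0")
    case True
    then show ?thesis using p unfolding eq by (simp add: energy_param_def)
  next
    case False
    then obtain k where k: "N = 2 * k" using a by (auto elim: evenE)
    have "sqrt (2 * ((p\<^sup>2 + 0\<^sup>2) / 2 + F p 0)) ^ N = (2 * ((p\<^sup>2 + 0\<^sup>2) / 2 + F p 0)) ^ k"
      using H unfolding k power_mult by (subst real_sqrt_pow2) auto
    also have "\<dots> = energy_param N (F 1 0) p"
      unfolding eq by (simp add: energy_param_def k power_mult_distrib power_mult)
    finally show ?thesis .
  qed
qed

text \<open>The value at e = 0 is 2 pi, so c = 2 pi. The midpoint inequalities for the two halves
  add up to 2 c < c + 2 pi, a contradiction. Working in e instead of p makes the argument valid for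
  odd forms that do not vanish on the axis.\<close>

lemma equal_level_sum_not_const:
  assumes N: "N \<ge> 1" and F: "homogeneous_poly (N + 2) F" and G: "homogeneous_poly (N + 2) G"
    and "\<eta> > 0" and const: "\<And>e. e \<in> {0<..<\<eta>} \<Longrightarrow> half_period N (profile F) e + half_period N (profile G) e = c"
  shows False
proof -
  let ?f = "profile F" and ?g = "profile G"
  note f = continuous_on_profile[OF F] and g = continuous_on_profile[OF G]
  obtain A B where A: "A > 0" "\<And>x y. \<bar>F x y\<bar> \<le> A * sqrt (x\<^sup>2 + y\<^sup>2) ^ (N + 2)"
    and B: "B > 0" "\<And>x y. \<bar>G x y\<bar> \<le> B * sqrt (x\<^sup>2 + y\<^sup>2) ^ (N + 2)"
    using homogeneous_poly_bound[OF F] homogeneous_poly_bound[OF G] by metis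
  define M where "M = A + B"
  have M: "M > 0" "\<bar>?f t\<bar> \<le> M" "\<bar>?g t\<bar> \<le> M" for t
    using A B A(2)[of "cos t" "sin t"] B(2)[of "cos t" "sin t"] by (auto simp: M_def profile_def)
  define \<kappa> where "\<kappa> = min (min 1 \<eta>) (- crit_level N / M)"
  have \<kappa>: "\<kappa> > 0" "\<kappa> \<le> 1" "\<kappa> \<le> \<eta>" "\<kappa> * M \<le> - crit_level N"
  proof -
    show "\<kappa> > 0" using \<open>\<eta> > 0\<close> M(1) crit_level_neg[OF N] by (simp add: \<kappa>_def divide_neg_pos)
    have "\<kappa> \<le> - crit_level N / M" by (simp add: \<kappa>_def)
    then show "\<kappa> * M \<le> - crit_level N" unfolding pos_le_divide_eq[OF M(1)] .
  qed (auto simp: \<kappa>_def)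
  have crit: "crit_level N < e * h" if "0 \<le> e" "e < \<kappa>" "\<bar>h\<bar> \<le> M" for e h
  proof -
    have "e * (- M) \<le> e * h" using that by (intro mult_left_mono) auto
    moreover have "e * M < \<kappa> * M" using that M(1) by (intro mult_strict_right_mono) auto
    ultimately show ?thesis using \<kappa>(4) by simp
  qed
  have pow: "0 \<le> p ^ N" "p ^ N < \<kappa>" if "p \<in> {0..<\<kappa>}" for p
  proof -
    have "p ^ N \<le> p ^ 1" using that \<kappa>(2) N by (intro power_decreasing) auto
    then show "0 \<le> p ^ N" "p ^ N < \<kappa>" using that by auto
  qed
  \<comment> \<open>With a = 0 the energy parameter is p^N. This p is auxiliary, not a starting
    point; it makes the continuation down to 0 available.\<close>
  have an: "analytic_below (\<lambda>p. half_period N ?f (p ^ N)) \<kappa>" "analytic_below (\<lambda>p. half_period N ?g (p ^ N)) \<kappa>"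
    using analytic_below_half_period[OF N f, of \<kappa> 0] analytic_below_half_period[OF N g, of \<kappa> 0] crit pow M
    by (simp_all add: energy_param_def)
  have ev: "\<forall>\<^sub>F p in at_right 0. half_period N ?f (p ^ N) + half_period N ?g (p ^ N) = c"
    using eventually_at_right_real[OF \<kappa>(1)]
  proof eventually_elim
    case (elim p)
    then show ?case using pow[of p] \<kappa>(3) by (intro const) auto
  qed
  have "half_period N ?f (0 ^ N) + half_period N ?g (0 ^ N) = c"
    by (rule analytic_below_eq_const[OF analytic_below_add[OF an] \<kappa>(1) ev]) (use \<kappa>(1) in auto)
  then have c: "c = 2 * pi"
    using N half_period_0[OF N f] half_period_0[OF N g] by (simp add: power_0_left)
  define e where "e = \<kappa> / 2"
  have e: "0 < e" "e < \<kappa>" using \<kappa>(1) by (auto simp: e_def)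
  obtain s where s: "s \<in> {0..pi}" "?f s \<noteq> 0" using profile_nonzero[OF F] by blast
  have "2 * half_period N ?f (e / 2) < half_period N ?f e + pi"
    by (rule half_period_midpoint(2)[OF N f _ e(1) s]) (use e M in \<open>auto intro!: crit\<close>)
  moreover have "2 * half_period N ?g (e / 2) \<le> half_period N ?g e + pi"
    by (rule half_period_midpoint(1)[OF N g _ e(1)]) (use e M in \<open>auto intro!: crit\<close>)
  moreover have "half_period N ?f e + half_period N ?g e = c" "half_period N ?f (e / 2) + half_period N ?g (e / 2) = c"
    using e \<kappa>(3) by (auto intro!: const)
  ultimately show False using c by simp
qed

section \<open>Matching the endpoints of the two arcs\<close>

definition oscillator :: "(real \<Rightarrow> real \<Rightarrow> real) \<Rightarrow> real \<Rightarrow> real \<Rightarrow> real" where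
  "oscillator F = (\<lambda>x y. (x\<^sup>2 + y\<^sup>2) / 2 + F x y)"

text \<open>Reflection in the x-axis turns a Hamiltonian field into the negative of the field of the
  reflected Hamiltonian, and reversing time restores the sign.\<close>

lemma trajectory_reflect:
  assumes F: "homogeneous_poly d F"
    and traj: "trajectory_on (hamiltonian_field (oscillator F)) {0..T} \<gamma>"
  shows "trajectory_on (hamiltonian_field (oscillator (\<lambda>x y. F x (- y)))) {0..T}
           (\<lambda>t. (fst (\<gamma> (T - t)), - snd (\<gamma> (T - t))))"
proof -
  obtain Fx Fy where partials: "has_partials F Fx Fy"
    using homogeneous_poly_partials[OF F] by metis
  have partials': "has_partials (\<lambda>x y. F x (- y)) (\<lambda>x y. Fx x (- y)) (\<lambda>x y. - Fy x (- y))"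
    unfolding has_partials_def
  proof (intro allI impI)
    fix x y x' y' t S
    assume x: "(x has_real_derivative x') (at t within S)" and y: "(y has_real_derivative y') (at t within S)"
    from has_partialsD[OF partials x DERIV_minus[OF y]]
    show "((\<lambda>t. F (x t) (- y t)) has_real_derivative Fx (x t) (- y t) * x' + - Fy (x t) (- y t) * y') (at t within S)"
      by simp
  qed
  have rev: "((\<lambda>t. f (T - t)) has_real_derivative - D) (at t within {0..T})"
    if "(f has_real_derivative D) (at (T - t) within {0..T})" for f D t
  proof -
    have "(\<lambda>t. T - t) ` {0..T} = {0..T}" by (auto intro!: image_eqI[of _ _ "T - x" for x])
    then have "(f \<circ> (\<lambda>t. T - t) has_real_derivative D * (- 1)) (at t within {0..T})"
      using that by (intro DERIV_image_chain) (auto intro!: derivative_eq_intros)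
    then show ?thesis by (simp add: o_def)
  qed
  show ?thesis
    unfolding trajectory_components[OF partials' oscillator_def]
  proof (intro ballI conjI)
    fix t assume "t \<in> {0..T}"
    then have "T - t \<in> {0..T}" by auto
    then have dx: "((\<lambda>t. fst (\<gamma> t)) has_real_derivative
          - (snd (\<gamma> (T - t)) + Fy (fst (\<gamma> (T - t))) (snd (\<gamma> (T - t))))) (at (T - t) within {0..T})"
      and dy: "((\<lambda>t. snd (\<gamma> t)) has_real_derivative
          fst (\<gamma> (T - t)) + Fx (fst (\<gamma> (T - t))) (snd (\<gamma> (T - t)))) (at (T - t) within {0..T})"
      using traj unfolding trajectory_components[OF partials oscillator_def] by auto
    from rev[OF dx]
    show "((\<lambda>t. fst (fst (\<gamma> (T - t)), - snd (\<gamma> (T - t)))) has_real_derivative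
        - (snd (fst (\<gamma> (T - t)), - snd (\<gamma> (T - t))) +
           - Fy (fst (fst (\<gamma> (T - t)), - snd (\<gamma> (T - t)))) (- snd (fst (\<gamma> (T - t)), - snd (\<gamma> (T - t))))))
        (at t within {0..T})" by simp
    from DERIV_minus[OF rev[OF dy]]
    show "((\<lambda>t. snd (fst (\<gamma> (T - t)), - snd (\<gamma> (T - t)))) has_real_derivative
        fst (fst (\<gamma> (T - t)), - snd (\<gamma> (T - t))) +
           Fx (fst (fst (\<gamma> (T - t)), - snd (\<gamma> (T - t)))) (- snd (fst (\<gamma> (T - t)), - snd (\<gamma> (T - t)))))
        (at t within {0..T})" by (simp add: add.commute)
  qed
qed

lemma lower_arc_iff_upper_arc_reflect:
  assumes F: "homogeneous_poly d F"
  shows "lower_arc (hamiltonian_field (oscillator F)) p q T \<longleftrightarrow>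
         upper_arc (hamiltonian_field (oscillator (\<lambda>x y. F x (- y)))) p q T"
proof
  assume "lower_arc (hamiltonian_field (oscillator F)) p q T"
  then obtain \<gamma> where T: "T > 0" "q < 0" and \<gamma>: "trajectory_on (hamiltonian_field (oscillator F)) {0..T} \<gamma>"
    "\<gamma> 0 = (q, 0)" "\<gamma> T = (p, 0)" "\<And>t. t \<in> {0<..<T} \<Longrightarrow> snd (\<gamma> t) < 0"
    unfolding lower_arc_def by blast
  show "upper_arc (hamiltonian_field (oscillator (\<lambda>x y. F x (- y)))) p q T"
    unfolding upper_arc_def
    using T \<gamma>(2-4) trajectory_reflect[OF F \<gamma>(1)]
    by (intro conjI exI[of _ "\<lambda>t. (fst (\<gamma> (T - t)), - snd (\<gamma> (T - t)))"]) auto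
next
  assume "upper_arc (hamiltonian_field (oscillator (\<lambda>x y. F x (- y)))) p q T"
  then obtain \<gamma> where T: "T > 0" "q < 0"
    and \<gamma>: "trajectory_on (hamiltonian_field (oscillator (\<lambda>x y. F x (- y)))) {0..T} \<gamma>"
    "\<gamma> 0 = (p, 0)" "\<gamma> T = (q, 0)" "\<And>t. t \<in> {0<..<T} \<Longrightarrow> snd (\<gamma> t) > 0"
    unfolding upper_arc_def by blast
  show "lower_arc (hamiltonian_field (oscillator F)) p q T"
    unfolding lower_arc_def
    using T \<gamma>(2-4) trajectory_reflect[OF homogeneous_poly_reflect[OF F] \<gamma>(1)]
    by (intro conjI exI[of _ "\<lambda>t. (fst (\<gamma> (T - t)), - snd (\<gamma> (T - t)))"]) auto
qed

lemma oscillator_axis: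
  "homogeneous_poly d F \<Longrightarrow> oscillator F x 0 = x\<^sup>2 / 2 + F 1 0 * x ^ d"
  using homogeneous_poly_axis[of d F x] by (simp add: oscillator_def mult.commute)

lemma upper_arc_energy:
  assumes F: "homogeneous_poly d F" and arc: "upper_arc (hamiltonian_field (oscillator F)) p q T"
  shows "oscillator F p 0 = oscillator F q 0"
proof -
  obtain \<gamma> where "T > 0" "trajectory_on (hamiltonian_field (oscillator F)) {0..T} \<gamma>" "\<gamma> 0 = (p, 0)" "\<gamma> T = (q, 0)"
    using arc unfolding upper_arc_def by blast
  then show ?thesis
    using hamiltonian_conserved[OF F oscillator_def, of T \<gamma> T] by simp
qed

section \<open>Quadratic forms and their linear fields\<close>

lemma quadratic_form_partials:
  assumes "homogeneous_poly 2 F"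
  obtains b c where "has_partials F (\<lambda>x y. 2 * F 1 0 * x + b * y) (\<lambda>x y. b * x + c * y)"
proof -
  obtain c where c: "\<And>x y. F x y = (\<Sum>i\<le>2. c i * x ^ i * y ^ (2 - i))"
    using assms unfolding homogeneous_poly_def by blast
  have F: "F x y = c 0 * y\<^sup>2 + c 1 * x * y + c 2 * x\<^sup>2" for x y
    unfolding c by (simp add: numeral_2_eq_2)
  have "has_partials F (\<lambda>x y. 2 * F 1 0 * x + c 1 * y) (\<lambda>x y. c 1 * x + 2 * c 0 * y)"
    unfolding has_partials_def F
    by (auto intro!: derivative_eq_intros simp: algebra_simps)
  then show thesis by (rule that)
qed

text \<open>Equal energies at both ends give (1/2 + a) (p^2 - q^2) = 0 with a =
  \<open>F 1 0\<close>. If the first factor were 0, the second component would satisfy y' = b y, and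
  an arc starting on the x-axis could not leave it.\<close>

lemma linear_arc_endpoint:
  assumes F: "homogeneous_poly 2 F" and p: "p > 0"
    and arc: "upper_arc (hamiltonian_field (oscillator F)) p q T"
  shows "q = - p"
proof -
  obtain b c where partials: "has_partials F (\<lambda>x y. 2 * F 1 0 * x + b * y) (\<lambda>x y. b * x + c * y)"
    using quadratic_form_partials[OF F] by blast
  obtain \<gamma> where T: "T > 0" "q < 0" and \<gamma>: "trajectory_on (hamiltonian_field (oscillator F)) {0..T} \<gamma>"
    "\<gamma> 0 = (p, 0)" "\<gamma> T = (q, 0)" "\<And>t. t \<in> {0<..<T} \<Longrightarrow> snd (\<gamma> t) > 0"
    using arc unfolding upper_arc_def by blast
  have "1 / 2 + F 1 0 \<noteq> 0"
  proof
    assume "1 / 2 + F 1 0 = 0"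
    then have a: "F 1 0 = - 1 / 2" by simp
    define g where "g = (\<lambda>t. snd (\<gamma> t) * exp (- b * t))"
    have "(g has_real_derivative 0) (at t within {0..T})" if "t \<in> {0..T}" for t
    proof -
      have "((\<lambda>t. snd (\<gamma> t)) has_real_derivative b * snd (\<gamma> t)) (at t within {0..T})"
        using \<gamma>(1) that unfolding trajectory_components[OF partials oscillator_def] by (simp add: a)
      then show ?thesis
        unfolding g_def by (auto intro!: derivative_eq_intros simp: algebra_simps)
    qed
    then obtain k where "\<forall>t\<in>{0..T}. g t = k"
      using has_field_derivative_zero_constant[of "{0..T}" g] by auto
    then have "g (T / 2) = g 0" using T by simp
    then show False using \<gamma>(2) \<gamma>(4)[of "T / 2"] T by (simp add: g_def)
  qed
  moreover have "(1 / 2 + F 1 0) * (p\<^sup>2 - q\<^sup>2) = 0"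
    using upper_arc_energy[OF F arc] by (simp add: oscillator_axis[OF F] algebra_simps)
  ultimately have "p\<^sup>2 = q\<^sup>2" by simp
  then show ?thesis using p T by (auto simp: power2_eq_iff)
qed

lemma linear_arc_scale:
  assumes F: "homogeneous_poly 2 F" and k: "k > 0"
    and arc: "upper_arc (hamiltonian_field (oscillator F)) p q T"
  shows "upper_arc (hamiltonian_field (oscillator F)) (k * p) (k * q) T"
proof -
  obtain b c where partials: "has_partials F (\<lambda>x y. 2 * F 1 0 * x + b * y) (\<lambda>x y. b * x + c * y)"
    using quadratic_form_partials[OF F] by blast
  obtain \<gamma> where T: "T > 0" "q < 0" and \<gamma>: "trajectory_on (hamiltonian_field (oscillator F)) {0..T} \<gamma>"
    "\<gamma> 0 = (p, 0)" "\<gamma> T = (q, 0)" "\<And>t. t \<in> {0<..<T} \<Longrightarrow> snd (\<gamma> t) > 0"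
    using arc unfolding upper_arc_def by blast
  have "trajectory_on (hamiltonian_field (oscillator F)) {0..T} (\<lambda>t. (k * fst (\<gamma> t), k * snd (\<gamma> t)))"
    unfolding trajectory_components[OF partials oscillator_def]
  proof (intro ballI conjI)
    fix t assume "t \<in> {0..T}"
    then have dx: "((\<lambda>t. fst (\<gamma> t)) has_real_derivative
          - (snd (\<gamma> t) + (b * fst (\<gamma> t) + c * snd (\<gamma> t)))) (at t within {0..T})"
      and dy: "((\<lambda>t. snd (\<gamma> t)) has_real_derivative
          fst (\<gamma> t) + (2 * F 1 0 * fst (\<gamma> t) + b * snd (\<gamma> t))) (at t within {0..T})"
      using \<gamma>(1) unfolding trajectory_components[OF partials oscillator_def] by auto
    show "((\<lambda>t. fst (k * fst (\<gamma> t), k * snd (\<gamma> t))) has_real_derivative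
        - (snd (k * fst (\<gamma> t), k * snd (\<gamma> t)) +
            (b * fst (k * fst (\<gamma> t), k * snd (\<gamma> t)) + c * snd (k * fst (\<gamma> t), k * snd (\<gamma> t))))) (at t within {0..T})"
      using DERIV_cmult[OF dx, of k] by (simp add: algebra_simps)
    show "((\<lambda>t. snd (k * fst (\<gamma> t), k * snd (\<gamma> t))) has_real_derivative
        fst (k * fst (\<gamma> t), k * snd (\<gamma> t)) +
            (2 * F 1 0 * fst (k * fst (\<gamma> t), k * snd (\<gamma> t)) + b * snd (k * fst (\<gamma> t), k * snd (\<gamma> t)))) (at t within {0..T})"
      using DERIV_cmult[OF dy, of k] by (simp add: algebra_simps)
  qed
  then show ?thesis
    unfolding upper_arc_def using T \<gamma>(2-4) k
    by (intro conjI exI[of _ "\<lambda>t. (k * fst (\<gamma> t), k * snd (\<gamma> t))"]) (auto simp: mult_pos_neg)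
qed

section \<open>Endpoints common to both arcs\<close>

lemma even_level_endpoint:
  fixes a p q :: real
  assumes d: "even d" and small: "\<bar>a\<bar> * real d * (2 * p) < 1" "2 * p \<le> 1" "3 \<le> d"
    and p: "0 < p" and q: "q < 0" "\<bar>q\<bar> \<le> 2 * p"
    and eq: "p\<^sup>2 / 2 + a * p ^ d = q\<^sup>2 / 2 + a * q ^ d"
  shows "q = - p"
proof -
  define g where "g = (\<lambda>t. t\<^sup>2 / 2 + a * t ^ d)"
  \<comment> \<open>Both p and -q lie in (0, 2 p], and g is even; strict monotonicity there
    identifies the two points.\<close>
  have mono: "g u < g v" if uv: "0 < u" "u < v" "v \<le> 2 * p" for u v
  proof (rule DERIV_pos_imp_increasing[OF uv(2)])
    fix t assume t: "u \<le> t" "t \<le> v"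
    then have t': "0 < t" "t \<le> 2 * p" using uv by auto
    have "d - 1 = Suc (d - 2)" using small(3) by simp
    then have d1: "t ^ (d - 1) = t * t ^ (d - 2)" by (simp only: power_Suc)
    have "t ^ (d - 2) \<le> t ^ 1" using t' small by (intro power_decreasing) auto
    then have "\<bar>a\<bar> * real d * t ^ (d - 2) \<le> \<bar>a\<bar> * real d * (2 * p)"
      using t' by (intro mult_left_mono) auto
    then have "\<bar>a * real d * t ^ (d - 2)\<bar> < 1" using small(1) t' by (simp add: abs_mult)
    then have "0 < t * (1 + a * real d * t ^ (d - 2))" using t' by (intro mult_pos_pos) auto
    moreover have "(g has_real_derivative t * (1 + a * real d * t ^ (d - 2))) (at t)"
    proof -
      have "(g has_real_derivative t + a * (real d * t ^ (d - 1))) (at t)"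
        unfolding g_def by (auto intro!: derivative_eq_intros)
      moreover have "t + a * (real d * t ^ (d - 1)) = t * (1 + a * real d * t ^ (d - 2))"
        unfolding d1 by (simp add: distrib_left)
      ultimately show ?thesis by simp
    qed
    ultimately show "\<exists>y. (g has_real_derivative y) (at t) \<and> 0 < y" by blast
  qed
  have "g p = g (- q)" using eq d by (simp add: g_def)
  then show ?thesis using mono[of p "- q"] mono[of "- q" p] p q by (cases "p < - q"; cases "- q < p") auto
qed

text \<open>On the axis a form reduces to its value at (1, 0) times a power, so a and b are all that
  the endpoints see. The bound on |q| keeps q small together with p.\<close>

definition same_endpoints :: "nat \<Rightarrow> real \<Rightarrow> nat \<Rightarrow> real \<Rightarrow> real \<Rightarrow> bool" where
  "same_endpoints N a K b r \<longleftrightarrow> r > 0 \<and> (\<forall>p\<in>{0<..<r}. \<exists>q<0. \<bar>q\<bar> \<le> 2 * p \<and>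
     p\<^sup>2 / 2 + a * p ^ (N + 2) = q\<^sup>2 / 2 + a * q ^ (N + 2) \<and>
     p\<^sup>2 / 2 + b * p ^ (K + 2) = q\<^sup>2 / 2 + b * q ^ (K + 2))"

lemma same_endpointsE:
  assumes "same_endpoints N a K b r" "p \<in> {0<..<r}"
  obtains q where "q < 0" "\<bar>q\<bar> \<le> 2 * p"
     "p\<^sup>2 / 2 + a * p ^ (N + 2) = q\<^sup>2 / 2 + a * q ^ (N + 2)"
     "p\<^sup>2 / 2 + b * p ^ (K + 2) = q\<^sup>2 / 2 + b * q ^ (K + 2)"
  using assms unfolding same_endpoints_def by blast

lemma same_endpoints_sym: "same_endpoints N a K b r \<Longrightarrow> same_endpoints K b N a r"
  unfolding same_endpoints_def by blast

lemma odd_level_symmetric_endpoint: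
  fixes b p :: real
  assumes "odd d" "p > 0" "p\<^sup>2 / 2 + b * p ^ d = (- p)\<^sup>2 / 2 + b * (- p) ^ d"
  shows "b = 0"
  using assms by simp

lemma same_endpoints_even_odd:
  assumes "same_endpoints N a K b r" "N \<ge> 1" "even N" "odd K"
  shows "b = 0"
proof -
  \<comment> \<open>With p * c <= 1/4 both smallness conditions of
    \<open>even_level_endpoint\<close> hold at once.\<close>
  define c where "c = 1 + \<bar>a\<bar> * real (N + 2)"
  have c: "c \<ge> 1" by (simp add: c_def)
  define p where "p = min (r / 2) (1 / (4 * c))"
  have r: "r > 0" using assms(1) by (simp add: same_endpoints_def)
  have p: "0 < p" "p < r" using r c by (auto simp: p_def)
  have "p \<le> 1 / (4 * c)" by (simp add: p_def)
  then have pc: "2 * (p * c) \<le> 1 / 2" using c by (simp add: pos_le_divide_eq)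
  have "p * 1 \<le> p * c" using p c by (intro mult_left_mono) auto
  then have small: "\<bar>a\<bar> * real (N + 2) * (2 * p) < 1" "2 * p \<le> 1"
  proof -
    assume le: "p * 1 \<le> p * c"
    then show "2 * p \<le> 1" using pc by simp
    have "\<bar>a\<bar> * real (N + 2) * (2 * p) = (c - 1) * (2 * p)" by (simp add: c_def)
    also have "\<dots> = 2 * (p * c) - 2 * p" by (simp add: algebra_simps)
    finally show "\<bar>a\<bar> * real (N + 2) * (2 * p) < 1" using pc p(1) by linarith
  qed
  obtain q where q: "q < 0" "\<bar>q\<bar> \<le> 2 * p"
     "p\<^sup>2 / 2 + a * p ^ (N + 2) = q\<^sup>2 / 2 + a * q ^ (N + 2)"
     "p\<^sup>2 / 2 + b * p ^ (K + 2) = q\<^sup>2 / 2 + b * q ^ (K + 2)"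
    using same_endpointsE[OF assms(1), of p] p by auto
  have "q = - p"
    by (rule even_level_endpoint[OF _ small _ p(1) q(1,2,3)]) (use assms in auto)
  with q(4) show ?thesis
    using odd_level_symmetric_endpoint[of "K + 2" p b] assms(4) p by simp
qed

text \<open>Here Q = -q. For odd degrees both energy equations compute the same quantity (Q^2 - p^2)
  / 2, which makes the two coefficients comparable.\<close>

lemma same_endpoints_odd:
  assumes "same_endpoints N a K b r" "odd N" "odd K" "p \<in> {0<..<r}"
  obtains Q where "0 < Q" "Q \<le> 2 * p" "(Q\<^sup>2 - p\<^sup>2) / 2 = a * (p ^ (N + 2) + Q ^ (N + 2))"
    "(Q\<^sup>2 - p\<^sup>2) / 2 = b * (p ^ (K + 2) + Q ^ (K + 2))"
proof -
  obtain q where q: "q < 0" "\<bar>q\<bar> \<le> 2 * p"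
     "p\<^sup>2 / 2 + a * p ^ (N + 2) = q\<^sup>2 / 2 + a * q ^ (N + 2)"
     "p\<^sup>2 / 2 + b * p ^ (K + 2) = q\<^sup>2 / 2 + b * q ^ (K + 2)"
    using same_endpointsE[OF assms(1,4)] by metis
  have neg: "q ^ (N + 2) = - ((- q) ^ (N + 2))" "q ^ (K + 2) = - ((- q) ^ (K + 2))" using assms(2,3) by auto
  show thesis
    by (rule that[of "- q"]) (use q(1,2) q(3,4)[unfolded neg] in \<open>auto simp: field_simps\<close>)
qed

lemma same_endpoints_odd_equal:
  assumes "same_endpoints N a N b r" "odd N"
  shows "a = b"
proof -
  have r: "r / 2 \<in> {0<..<r}" using assms(1) by (simp add: same_endpoints_def)
  obtain Q where Q: "0 < Q" "a * ((r / 2) ^ (N + 2) + Q ^ (N + 2)) = b * ((r / 2) ^ (N + 2) + Q ^ (N + 2))"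
    using same_endpoints_odd[OF assms(1,2,2) r] by metis
  have "(r / 2) ^ (N + 2) + Q ^ (N + 2) > 0"
    using r Q(1) by (intro add_pos_pos zero_less_power) auto
  with Q(2) show ?thesis by simp
qed

text \<open>For small p the sum of the higher powers is negligible against that of the lower powers,
  so the coefficient a of the lower degree vanishes; b then multiplies a positive sum and vanishes
  as well.\<close>

lemma same_endpoints_odd_less:
  assumes "same_endpoints N a K b r" "odd N" "odd K" "N < K"
  shows "a = 0" "b = 0"
proof -
  show a: "a = 0"
  proof (rule ccontr)
    assume "a \<noteq> 0"
    \<comment> \<open>The last bound makes 2 p |b| smaller than |a|, and 2 p <= 1 lets the higher
      power be estimated by 2 p times the lower one.\<close>
    define p where "p = min (r / 2) (min (1 / 2) (\<bar>a\<bar> / (4 * (1 + \<bar>b\<bar>))))"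
    have r: "r > 0" using assms(1) by (simp add: same_endpoints_def)
    have p: "p \<in> {0<..<r}" "2 * p \<le> 1" using r \<open>a \<noteq> 0\<close> by (auto simp: p_def divide_pos_pos add_pos_nonneg)
    have "p \<le> \<bar>a\<bar> / (4 * (1 + \<bar>b\<bar>))" by (simp add: p_def)
    then have "p * (4 * (1 + \<bar>b\<bar>)) \<le> \<bar>a\<bar>" by (subst (asm) pos_le_divide_eq) auto
    moreover have "\<bar>b\<bar> * (2 * p) < p * (4 * (1 + \<bar>b\<bar>))" using p by (simp add: algebra_simps add_strict_increasing)
    ultimately have small: "\<bar>b\<bar> * (2 * p) < \<bar>a\<bar>" by linarith
    obtain Q where Q: "0 < Q" "Q \<le> 2 * p" "a * (p ^ (N + 2) + Q ^ (N + 2)) = b * (p ^ (K + 2) + Q ^ (K + 2))"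
      using same_endpoints_odd[OF assms(1,2,3) p(1)] by metis
    have pow: "x ^ (K + 2) \<le> 2 * p * x ^ (N + 2)" if "0 < x" "x \<le> 2 * p" for x
    proof -
      have "x ^ (K + 2) = x ^ (K - N) * x ^ (N + 2)" using assms(4) by (simp flip: power_add)
      also have "x ^ (K - N) \<le> x ^ 1" using that p assms(4) by (intro power_decreasing) auto
      then have "x ^ (K - N) * x ^ (N + 2) \<le> 2 * p * x ^ (N + 2)" using that by (intro mult_right_mono) auto
      finally show ?thesis .
    qed
    define S where "S = p ^ (N + 2) + Q ^ (N + 2)"
    have S: "S > 0" using p Q(1) unfolding S_def by (intro add_pos_pos zero_less_power) auto
    have R: "p ^ (K + 2) + Q ^ (K + 2) \<le> 2 * p * S"
      unfolding S_def distrib_left by (intro add_mono pow) (use p Q in auto)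
    have R0: "0 \<le> p ^ (K + 2) + Q ^ (K + 2)"
      using p Q(1) by (intro add_nonneg_nonneg zero_le_power) auto
    have "\<bar>a\<bar> * S = \<bar>b\<bar> * (p ^ (K + 2) + Q ^ (K + 2))"
    proof -
      have "\<bar>a * S\<bar> = \<bar>b * (p ^ (K + 2) + Q ^ (K + 2))\<bar>" unfolding S_def Q(3) ..
      then show ?thesis unfolding abs_mult abs_of_pos[OF S] abs_of_nonneg[OF R0] .
    qed
    also have "\<dots> \<le> \<bar>b\<bar> * (2 * p * S)" using R by (rule mult_left_mono) simp
    also have "\<dots> = (\<bar>b\<bar> * (2 * p)) * S" by simp
    also have "\<dots> < \<bar>a\<bar> * S" using small S by (intro mult_strict_right_mono)
    finally show False by simp
  qed
  have r: "r / 2 \<in> {0<..<r}" using assms(1) by (simp add: same_endpoints_def)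
  obtain Q where Q: "0 < Q" "a * ((r / 2) ^ (N + 2) + Q ^ (N + 2)) = b * ((r / 2) ^ (K + 2) + Q ^ (K + 2))"
    using same_endpoints_odd[OF assms(1,2,3) r] by metis
  have "(r / 2) ^ (K + 2) + Q ^ (K + 2) > 0"
    using r Q(1) by (intro add_pos_pos zero_less_power) auto
  with Q(2) a show "b = 0" by simp
qed

lemma same_endpoints_cases:
  assumes "same_endpoints N a K b r" "N \<ge> 1" "K \<ge> 1"
  shows "N = K \<and> a = b \<or> (even N \<or> a = 0) \<and> (even K \<or> b = 0)"
proof -
  note S = assms(1) same_endpoints_sym[OF assms(1)]
  consider "even N" "even K" | "even N" "odd K" | "odd N" "even K" | "odd N" "odd K" "N = K"
    | "odd N" "odd K" "N < K" | "odd N" "odd K" "K < N"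
    by linarith
  then show ?thesis
    using same_endpoints_even_odd[OF S(1) assms(2)] same_endpoints_even_odd[OF S(2) assms(3)]
      same_endpoints_odd_equal[of N a b r] S same_endpoints_odd_less[OF S(1)] same_endpoints_odd_less[OF S(2)]
    by cases auto
qed

section \<open>Excluding isochronous pairs of upper arcs\<close>

definition isochronous_arcs :: "(real \<Rightarrow> real \<Rightarrow> real) \<Rightarrow> (real \<Rightarrow> real \<Rightarrow> real) \<Rightarrow> real \<Rightarrow> real \<Rightarrow> bool" where
  "isochronous_arcs F G \<epsilon> T0 \<longleftrightarrow> \<epsilon> > 0 \<and>
     (\<forall>p\<in>{0<..<\<epsilon>}. \<exists>q A B. upper_arc (hamiltonian_field (oscillator F)) p q A \<and>
        upper_arc (hamiltonian_field (oscillator G)) p q B) \<and>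
     (\<forall>p\<in>{0<..<\<epsilon>}. \<forall>q A B. upper_arc (hamiltonian_field (oscillator F)) p q A \<longrightarrow>
        upper_arc (hamiltonian_field (oscillator G)) p q B \<longrightarrow> A + B = T0)"

text \<open>Once the lower half is reflected, the two forms play the same role, so a linear half may
  be put first.\<close>

lemma isochronous_arcs_sym: "isochronous_arcs F G \<epsilon> T0 \<Longrightarrow> isochronous_arcs G F \<epsilon> T0"
  unfolding isochronous_arcs_def by (metis add.commute)

lemma oscillator_energy_param:
  assumes F: "homogeneous_poly (N + 2) F" and a: "even N \<or> F 1 0 = 0" and p: "p > 0" "oscillator F p 0 > 0"
  shows "sqrt (2 * oscillator F p 0) ^ N = energy_param N (F 1 0) p"
  using energy_param_eq[OF F a p(1)] p(2) by (simp add: oscillator_def)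

text \<open>A single arc of the linear half, rescaled, serves every small p with the same time A and
  endpoint -p. For odd K this symmetric endpoint forces \<open>G 1 0 = 0\<close>, so the dichotomy
  applies to G.\<close>

lemma not_isochronous_arcs_linear:
  assumes F: "homogeneous_poly 2 F" and K: "K \<ge> 1" and G: "homogeneous_poly (K + 2) G"
    and iso: "isochronous_arcs F G \<epsilon> T0"
  shows False
proof -
  note \<epsilon> = iso[unfolded isochronous_arcs_def]
  obtain \<delta> where \<delta>: "\<delta> > 0" "\<And>p q T. 0 < p \<Longrightarrow> p < \<delta> \<Longrightarrow> upper_arc (hamiltonian_field (oscillator G)) p q T \<Longrightarrow>
      oscillator G p 0 = oscillator G q 0 \<and> \<bar>q\<bar> \<le> 2 * p \<and> oscillator G p 0 > 0 \<and>
      T = half_period K (profile G) (sqrt (2 * oscillator G p 0) ^ K)"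
    using upper_arc_half_period[OF K G oscillator_def] by metis
  define p1 where "p1 = \<epsilon> / 2"
  have p1: "p1 \<in> {0<..<\<epsilon>}" using \<epsilon> by (simp add: p1_def)
  obtain q1 A where A: "upper_arc (hamiltonian_field (oscillator F)) p1 q1 A" using \<epsilon> p1 by blast
  have q1: "q1 = - p1" by (rule linear_arc_endpoint[OF F _ A]) (use p1 in auto)
  define r where "r = min \<epsilon> \<delta>"
  have r: "r > 0" using \<epsilon> \<delta>(1) by (simp add: r_def)
  have arcs: "upper_arc (hamiltonian_field (oscillator F)) p (- p) A \<and>
      (\<exists>B. upper_arc (hamiltonian_field (oscillator G)) p (- p) B)" if p: "p \<in> {0<..<r}" for p
  proof
    have "p \<in> {0<..<\<epsilon>}" using p by (simp add: r_def)
    then obtain q A' B where arcs: "upper_arc (hamiltonian_field (oscillator F)) p q A'"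
        "upper_arc (hamiltonian_field (oscillator G)) p q B" using \<epsilon> by blast
    have "q = - p" by (rule linear_arc_endpoint[OF F _ arcs(1)]) (use p in auto)
    with arcs(2) show "\<exists>B. upper_arc (hamiltonian_field (oscillator G)) p (- p) B" by blast
    show "upper_arc (hamiltonian_field (oscillator F)) p (- p) A"
      using linear_arc_scale[OF F _ A, of "p / p1"] p p1 q1 by simp
  qed
  have G0: "even K \<or> G 1 0 = 0"
  proof (cases "even K")
    case False
    have p: "r / 2 \<in> {0<..<r}" using r by simp
    obtain B where "upper_arc (hamiltonian_field (oscillator G)) (r / 2) (- (r / 2)) B" using arcs[OF p] by blast
    from upper_arc_energy[OF G this] have "G 1 0 = 0"
      unfolding oscillator_axis[OF G]
      by (rule odd_level_symmetric_endpoint[rotated 2]) (use False r in auto)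
    then show ?thesis ..
  qed simp
  let ?\<tau> = "\<lambda>p. half_period K (profile G) (energy_param K (G 1 0) p)"
  \<comment> \<open>The constant A is traded for pi, the value at 0 that
    \<open>sum_not_const\<close> expects of a summand.\<close>
  have "\<forall>\<^sub>F p in at_right 0. pi + ?\<tau> p = pi + (T0 - A)"
    using eventually_at_right_real[OF r]
  proof eventually_elim
    case (elim p)
    obtain B where B: "upper_arc (hamiltonian_field (oscillator G)) p (- p) B"
      and A: "upper_arc (hamiltonian_field (oscillator F)) p (- p) A" using arcs[OF elim] by blast
    have p: "p \<in> {0<..<\<epsilon>}" "0 < p" "p < \<delta>" using elim by (auto simp: r_def)
    have "A + B = T0" using \<epsilon> p(1) A B by blast
    moreover have "B = ?\<tau> p"
      using \<delta>(2)[OF p(2,3) B] oscillator_energy_param[OF G G0 p(2)] by simp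
    ultimately show ?case by simp
  qed
  moreover have "bounded_by_pi (\<lambda>_. pi)"
    by (simp add: bounded_by_pi_def analytic_below_const)
  ultimately show False
    using sum_not_const[of "\<lambda>_. pi" ?\<tau>] half_period_dichotomy[OF K G G0] by blast
qed

lemma not_isochronous_arcs_nonlinear:
  assumes N: "N \<ge> 1" and F: "homogeneous_poly (N + 2) F" and K: "K \<ge> 1" and G: "homogeneous_poly (K + 2) G"
    and iso: "isochronous_arcs F G \<epsilon> T0"
  shows False
proof -
  note \<epsilon> = iso[unfolded isochronous_arcs_def]
  let ?hF = "\<lambda>p. half_period N (profile F) (sqrt (2 * oscillator F p 0) ^ N)"
  let ?hG = "\<lambda>p. half_period K (profile G) (sqrt (2 * oscillator G p 0) ^ K)"
  obtain \<delta> where \<delta>: "\<delta> > 0" "\<And>p q T. 0 < p \<Longrightarrow> p < \<delta> \<Longrightarrow> upper_arc (hamiltonian_field (oscillator F)) p q T \<Longrightarrow>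
      oscillator F p 0 = oscillator F q 0 \<and> \<bar>q\<bar> \<le> 2 * p \<and> oscillator F p 0 > 0 \<and> T = ?hF p"
    using upper_arc_half_period[OF N F oscillator_def] by metis
  obtain \<delta>' where \<delta>': "\<delta>' > 0" "\<And>p q T. 0 < p \<Longrightarrow> p < \<delta>' \<Longrightarrow> upper_arc (hamiltonian_field (oscillator G)) p q T \<Longrightarrow>
      oscillator G p 0 = oscillator G q 0 \<and> \<bar>q\<bar> \<le> 2 * p \<and> oscillator G p 0 > 0 \<and> T = ?hG p"
    using upper_arc_half_period[OF K G oscillator_def] by metis
  define r where "r = min \<epsilon> (min \<delta> \<delta>')"
  have r: "r > 0" using \<epsilon> \<delta>(1) \<delta>'(1) by (simp add: r_def)
  have arcs: "(\<exists>q<0. oscillator F p 0 = oscillator F q 0 \<and> oscillator G p 0 = oscillator G q 0 \<and> \<bar>q\<bar> \<le> 2 * p) \<and>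
      oscillator F p 0 > 0 \<and> oscillator G p 0 > 0 \<and> ?hF p + ?hG p = T0" if "p \<in> {0<..<r}" for p
  proof -
    have p: "p \<in> {0<..<\<epsilon>}" "0 < p" "p < \<delta>" "p < \<delta>'" using that by (auto simp: r_def)
    obtain q A B where AB: "upper_arc (hamiltonian_field (oscillator F)) p q A"
        "upper_arc (hamiltonian_field (oscillator G)) p q B" using \<epsilon> p(1) by blast
    then have "A + B = T0" using \<epsilon> p(1) by blast
    moreover have "q < 0" using AB(1) by (simp add: upper_arc_def)
    ultimately show ?thesis
      using \<delta>(2)[OF p(2,3) AB(1)] \<delta>'(2)[OF p(2,4) AB(2)] by blast
  qed
  have "same_endpoints N (F 1 0) K (G 1 0) r"
    unfolding same_endpoints_def using r arcs by (fastforce simp: oscillator_axis[OF F] oscillator_axis[OF G])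
  from same_endpoints_cases[OF this N K] show False
  proof
    assume eq: "N = K \<and> F 1 0 = G 1 0"
    have FG: "oscillator G p 0 = oscillator F p 0" for p
      using eq by (simp add: oscillator_axis[OF F] oscillator_axis[OF G])
    \<comment> \<open>The parameter s^N common to both halves. By continuity it takes every value in
      (0, \<phi> (r / 2)), so the identity in p becomes one in e.\<close>
    define \<phi> where "\<phi> = (\<lambda>p. sqrt (2 * oscillator F p 0) ^ N)"
    have cont: "continuous_on S \<phi>" for S
      unfolding \<phi>_def oscillator_axis[OF F] by (intro continuous_intros) auto
    have \<phi>0: "\<phi> 0 = 0" using N by (simp add: \<phi>_def oscillator_axis[OF F] power_0_left)
    show False
    proof (rule equal_level_sum_not_const[OF N F])
      show "\<phi> (r / 2) > 0" using arcs[of "r / 2"] r by (simp add: \<phi>_def)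
      show "homogeneous_poly (N + 2) G" using G eq by simp
      fix e assume e: "e \<in> {0<..<\<phi> (r / 2)}"
      then obtain p where p: "0 \<le> p" "p \<le> r / 2" "\<phi> p = e"
        using IVT'[of \<phi> 0 e "r / 2"] \<phi>0 r cont by auto
      then have "p \<in> {0<..<r}" using e r \<phi>0 by (cases "p = 0") auto
      from arcs[OF this] show "half_period N (profile F) e + half_period N (profile G) e = T0"
        using eq p(3) by (simp add: FG \<phi>_def)
    qed
  next
    assume a: "(even N \<or> F 1 0 = 0) \<and> (even K \<or> G 1 0 = 0)"
    let ?\<sigma> = "\<lambda>p. half_period N (profile F) (energy_param N (F 1 0) p)"
    let ?\<tau> = "\<lambda>p. half_period K (profile G) (energy_param K (G 1 0) p)"
    have "\<forall>\<^sub>F p in at_right 0. ?\<sigma> p + ?\<tau> p = T0"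
      using eventually_at_right_real[OF r]
    proof eventually_elim
      case (elim p)
      then show ?case
        using arcs[OF elim] oscillator_energy_param[OF F, of p] oscillator_energy_param[OF G, of p] a by simp
    qed
    then show False
      using sum_not_const[of ?\<sigma> ?\<tau>] half_period_dichotomy[OF N F] half_period_dichotomy[OF K G] a by blast
  qed
qed

text \<open>At least one half is nonlinear here. For n = m = 1 both fields are linear and the period
  can be constant, as it is for two rotations.\<close>

lemma not_isochronous_arcs:
  assumes "n \<ge> 1" "m \<ge> 1" "\<not> (n = 1 \<and> m = 1)" "homogeneous_poly (n + 1) F" "homogeneous_poly (m + 1) G"
  shows "\<not> isochronous_arcs F G \<epsilon> T0"
proof
  assume iso: "isochronous_arcs F G \<epsilon> T0"
  have step: "k + 1 = (k - 1) + 2" if "k \<ge> 2" for k :: nat using that by simp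
  consider "n = 1" "m \<ge> 2" | "m = 1" "n \<ge> 2" | "n \<ge> 2" "m \<ge> 2" using assms(1-3) by linarith
  then show False
  proof cases
    case 1
    have "homogeneous_poly 2 F" using assms(4) 1(1) by (simp add: numeral_2_eq_2)
    moreover have "homogeneous_poly ((m - 1) + 2) G" using assms(5) unfolding step[OF 1(2)] .
    moreover have "m - 1 \<ge> 1" using 1(2) by simp
    ultimately show False using not_isochronous_arcs_linear[OF _ _ _ iso] by blast
  next
    case 2
    have "homogeneous_poly 2 G" using assms(5) 2(1) by (simp add: numeral_2_eq_2)
    moreover have "homogeneous_poly ((n - 1) + 2) F" using assms(4) unfolding step[OF 2(2)] .
    moreover have "n - 1 \<ge> 1" using 2(2) by simp
    ultimately show False using not_isochronous_arcs_linear[OF _ _ _ isochronous_arcs_sym[OF iso]] by blast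
  next
    case 3
    have "homogeneous_poly ((n - 1) + 2) F" using assms(4) unfolding step[OF 3(1)] .
    moreover have "homogeneous_poly ((m - 1) + 2) G" using assms(5) unfolding step[OF 3(2)] .
    moreover have "n - 1 \<ge> 1" "m - 1 \<ge> 1" using 3 by simp_all
    ultimately show False using not_isochronous_arcs_nonlinear[OF _ _ _ _ iso] by blast
  qed
qed

theorem theorem1:
  fixes n m :: nat and Fp Fm Hp Hm :: "real \<Rightarrow> real \<Rightarrow> real"
  assumes "n \<ge> 1" and "m \<ge> 1"
    and "\<not> (n = 1 \<and> m = 1)"
    and "homogeneous_poly (n + 1) Fp" and "homogeneous_poly (m + 1) Fm"
    and "Hp = (\<lambda>x y. (x\<^sup>2 + y\<^sup>2) / 2 + Fp x y)"
    and "Hm = (\<lambda>x y. (x\<^sup>2 + y\<^sup>2) / 2 + Fm x y)"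
  shows "\<not> isochronous_sigma_center (hamiltonian_field Hp) (hamiltonian_field Hm)"
proof
  assume iso: "isochronous_sigma_center (hamiltonian_field Hp) (hamiltonian_field Hm)"
  let ?G = "\<lambda>x y. Fm x (- y)"
  have H: "Hp = oscillator Fp" "Hm = oscillator Fm" using assms(6,7) by (simp_all add: oscillator_def)
  have closed: "closed_orbit_period (hamiltonian_field Hp) (hamiltonian_field Hm) p T \<longleftrightarrow>
      (\<exists>q A B. upper_arc (hamiltonian_field (oscillator Fp)) p q A \<and>
        upper_arc (hamiltonian_field (oscillator ?G)) p q B \<and> T = A + B)" for p T
    unfolding closed_orbit_period_def H lower_arc_iff_upper_arc_reflect[OF assms(5)] ..
  obtain \<epsilon>1 T0 \<epsilon>2 where \<epsilon>: "\<epsilon>1 > 0" "\<epsilon>2 > 0"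
    "\<And>p. p \<in> {0<..<\<epsilon>1} \<Longrightarrow> \<exists>T. closed_orbit_period (hamiltonian_field Hp) (hamiltonian_field Hm) p T"
    "\<And>p T. p \<in> {0<..<\<epsilon>2} \<Longrightarrow> closed_orbit_period (hamiltonian_field Hp) (hamiltonian_field Hm) p T \<Longrightarrow> T = T0"
    using iso unfolding isochronous_sigma_center_def sigma_center_def by blast
  have "isochronous_arcs Fp ?G (min \<epsilon>1 \<epsilon>2) T0"
    unfolding isochronous_arcs_def
  proof (intro conjI ballI allI impI)
    show "min \<epsilon>1 \<epsilon>2 > 0" using \<epsilon> by simp
    show "\<exists>q A B. upper_arc (hamiltonian_field (oscillator Fp)) p q A \<and>
        upper_arc (hamiltonian_field (oscillator ?G)) p q B" if "p \<in> {0<..<min \<epsilon>1 \<epsilon>2}" for p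
      using \<epsilon>(3)[of p] that unfolding closed by auto
    show "A + B = T0" if "p \<in> {0<..<min \<epsilon>1 \<epsilon>2}" "upper_arc (hamiltonian_field (oscillator Fp)) p q A"
        "upper_arc (hamiltonian_field (oscillator ?G)) p q B" for p q A B
      using \<epsilon>(4)[of p "A + B"] that unfolding closed by auto
  qed
  then show False
    using not_isochronous_arcs[OF assms(1-4) homogeneous_poly_reflect[OF assms(5)]] by blast
qed

end
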